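(* For any positive integers $k,s$ and every sufficiently large prime $p$, there is a set $A\subseteq\mathbb{Z}_{p^2s}$ with $(kp-k+1)s$ elements which is a $\lfloor k^2+2k^{3/2}\rfloor(s+1)$-Sidon set.
   Context: For a subset $A$ of $\mathbb{Z}_n=\mathbb{Z}/n\mathbb{Z}$, the representation function is $r(x)=\#\{(a_1,a_2): a_1,a_2\in A,\ a_1+a_2=x\}$ (ordered pairs). $A$ is a $g$-Sidon set if $r(x)\le g$ for all $x$. *)

theory Defs
  imports Complex_Main "HOL-Number_Theory.Residues"
begin

(* Subsets of Z/nZ are sets of integers contained in carrier (residue_ring (int n)) = {0..n-1};
   addition there is addition modulo n. *)

definition rep_count :: "nat \<Rightarrow> int set \<Rightarrow> int \<Rightarrow> nat" where
  "rep_count n A x =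
     card {(a1, a2). a1 \<in> A \<and> a2 \<in> A \<and> a1 \<oplus>\<^bsub>residue_ring (int n)\<^esub> a2 = x}"

definition g_sidon :: "nat \<Rightarrow> int \<Rightarrow> int set \<Rightarrow> bool" where
  "g_sidon n g A \<longleftrightarrow>
     A \<subseteq> carrier (residue_ring (int n)) \<and>
     (\<forall>x \<in> carrier (residue_ring (int n)). int (rep_count n A x) \<le> g)"

end

theory Submission
  imports Defs "HOL-Number_Theory.Euler_Criterion"
begin

text \<open>Take the union A of the k parabolas u y = x^2 in the plane over the field with p elements, where
  u = t + 1, ..., t + k. A point (a, b) has 1 + chi (u v) chi ((u + v) b - a^2) representations as
  a sum of a point on parabola u and a point on parabola v (chi is the Legendre symbol). The second
  character depends only on u + v, so (a, b) has at most
  k^2 + sum_w |C_w| representations, C_w being the sum of chi (u v) over u + v = w.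
  By Cauchy-Schwarz the claim follows from sum_w C_w^2 <= 4 k^3 / (2 k - 1) for some t. On average
  over t the trivial additive quadruples u + v = u' + v' contribute 2 k^2 - k to the left side,
  which is smaller, and the others contribute o(1): centring the quadruple and substituting x for
  the square of the variable reduces them to sums of chi (x (x - A) (x - B)), which are
  O(p^(3/4)) by an elementary argument of Davenport and Mordell (a fourth moment over all cubics)
  instead of Hasse's bound.

  Finally (a, b) is lifted to the s residues a + p (c + s b), 0 <= c < s, modulo p^2 s.\<close>


section \<open>Arithmetic modulo p and the Legendre symbol\<close>

locale odd_prime_residues =
  fixes p :: nat
  assumes prime_p: "prime p" and p_gt_3: "p > 3"
begin

definition R :: "int set" where "R = {0..<int p}"

definition chi :: "int \<Rightarrow> int" where "chi x = Legendre x (int p)"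

text \<open>Periodic functions are those that factor through the residues mod p. Only for these may
  a sum over the representatives \<open>R\<close> be reparametrised, so this predicate is what
  licenses every change of variable below.\<close>

definition periodic :: "(int \<Rightarrow> 'a) \<Rightarrow> bool" where
  "periodic F \<longleftrightarrow> (\<forall>x y. [x = y] (mod int p) \<longrightarrow> F x = F y)"

lemma finite_R [simp]: "finite R" and card_R [simp]: "card R = p"
  by (simp_all add: R_def)

lemma prime_int_p: "prime (int p)"
  using prime_p by simp

lemma mod_in_R [simp]: "x mod int p \<in> R"
  using p_gt_3 by (simp add: R_def)

lemma R_cong_iff: "x \<in> R \<Longrightarrow> y \<in> R \<Longrightarrow> [x = y] (mod int p) \<longleftrightarrow> x = y"
  by (simp add: R_def cong_def)

lemma cong_mult_left_iff:
  "\<not> int p dvd m \<Longrightarrow> [m * x = m * y] (mod int p) \<longleftrightarrow> [x = y] (mod int p)"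
  using cong_mult_lcancel[of m "int p" x y] prime_imp_coprime[OF prime_int_p] coprime_commute
  by blast

lemma bij_betw_affine_mod:
  assumes "\<not> int p dvd m"
  shows "bij_betw (\<lambda>x. (m * x + d) mod int p) R R"
proof -
  have "inj_on (\<lambda>x. (m * x + d) mod int p) R"
  proof (rule inj_onI)
    fix x y assume xy: "x \<in> R" "y \<in> R" "(m * x + d) mod int p = (m * y + d) mod int p"
    then have "[m * x = m * y] (mod int p)"
      using cong_add_rcancel[of "m * x" d "m * y" "int p"] by (simp add: cong_def)
    then show "x = y"
      using assms xy R_cong_iff cong_mult_left_iff by blast
  qed
  moreover have "(\<lambda>x. (m * x + d) mod int p) ` R \<subseteq> R" by auto
  ultimately show ?thesis
    by (simp add: bij_betw_def endo_inj_surj)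
qed

lemma sum_affine:
  assumes "periodic F" "\<not> int p dvd m"
  shows "(\<Sum>x\<in>R. F (m * x + d)) = (\<Sum>x\<in>R. F x)"
proof -
  have "(\<Sum>x\<in>R. F (m * x + d)) = (\<Sum>x\<in>R. F ((m * x + d) mod int p))"
    using assms(1) by (intro sum.cong) (auto simp: periodic_def)
  also have "\<dots> = (\<Sum>x\<in>R. F x)"
    by (rule sum.reindex_bij_betw[OF bij_betw_affine_mod[OF assms(2)]])
  finally show ?thesis .
qed

lemma not_dvd_1: "\<not> int p dvd 1"
  using p_gt_3 by (simp add: zdvd1_eq)

lemma sum_shift:
  "periodic F \<Longrightarrow> (\<Sum>x\<in>R. F (x + d)) = (\<Sum>x\<in>R. F x)"
  using sum_affine[of F 1 d] not_dvd_1 by simp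

lemma chi_cong: "[x = y] (mod int p) \<Longrightarrow> chi x = chi y"
proof -
  assume xy: "[x = y] (mod int p)"
  then have *: "[z = x] (mod int p) \<longleftrightarrow> [z = y] (mod int p)" for z
    by (simp add: cong_def)
  have "[x = 0] (mod int p) \<longleftrightarrow> [y = 0] (mod int p)"
    using xy by (simp add: cong_def)
  then show ?thesis
    by (simp only: chi_def Legendre_def QuadRes_def *)
qed

lemma periodic_chi: "periodic chi"
  by (simp add: periodic_def chi_cong)

lemma chi_cases: "chi x = 0 \<or> chi x = 1 \<or> chi x = -1"
  by (simp add: chi_def Legendre_def)

lemma chi_eq_0_iff: "chi x = 0 \<longleftrightarrow> int p dvd x"
  by (simp add: chi_def Legendre_def cong_0_iff)



text \<open>Euler's criterion gives the identity modulo p. Both sides lie in {-1, 0, 1}, so they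
  differ by at most 2 < p and are equal.\<close>

lemma chi_mult: "chi (x * y) = chi x * chi y"
proof -
  have e: "[chi z = z ^ ((p - 1) div 2)] (mod int p)" for z
    unfolding chi_def using euler_criterion[of p z] prime_p p_gt_3 by simp
  have "[chi (x * y) = chi x * chi y] (mod int p)"
    using cong_mult[OF e[of x] e[of y]] e[of "x * y"]
    by (metis cong_sym cong_trans power_mult_distrib)
  then have "int p dvd chi (x * y) - chi x * chi y"
    by (simp add: cong_iff_dvd_diff)
  moreover have "\<bar>chi (x * y) - chi x * chi y\<bar> \<le> 2"
    using chi_cases[of x] chi_cases[of y] chi_cases[of "x * y"] by auto
  ultimately show ?thesis
    using p_gt_3 zdvd_imp_le[of "int p" "\<bar>chi (x * y) - chi x * chi y\<bar>"] by force
qed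

lemma chi_power2: "\<not> int p dvd x \<Longrightarrow> chi (x\<^sup>2) = 1"
  using chi_cases[of x] chi_eq_0_iff[of x] by (auto simp: power2_eq_square chi_mult)

lemma dvd_power2_iff: "int p dvd x\<^sup>2 \<longleftrightarrow> int p dvd x"
  using prime_int_p by (simp add: prime_dvd_power_iff)

lemma cong_power2_iff: "[x\<^sup>2 = y\<^sup>2] (mod int p) \<longleftrightarrow> [x = y] (mod int p) \<or> [x = - y] (mod int p)"
proof -
  have "x\<^sup>2 - y\<^sup>2 = (x - y) * (x - (- y))" by (simp add: power2_eq_square algebra_simps)
  then show ?thesis
    using prime_int_p by (simp only: cong_iff_dvd_diff prime_dvd_mult_iff)
qed

lemma not_dvd_small: "0 < n \<Longrightarrow> n < int p \<Longrightarrow> \<not> int p dvd n"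
  using zdvd_not_zless by blast

text \<open>This turns point counts into character sums. If p does not divide x, one root y brings
  exactly the second root -y, distinct from y because p is odd; if p divides x, the only root is
  0.\<close>

lemma card_sqrt: "int (card {z\<in>R. [z\<^sup>2 = x] (mod int p)}) = 1 + chi x"
proof (cases "int p dvd x")
  case True
  have "{z\<in>R. [z\<^sup>2 = x] (mod int p)} = {0}"
  proof -
    have "[z\<^sup>2 = x] (mod int p) \<longleftrightarrow> int p dvd z" for z
      using True dvd_power2_iff[of z] by (meson cong_0_iff cong_sym cong_trans)
    moreover have "z \<in> R \<and> int p dvd z \<longleftrightarrow> z = 0" for z
      using zdvd_not_zless[of z "int p"] p_gt_3 by (cases "z = 0") (auto simp: R_def)
    ultimately show ?thesis by blast
  qed
  then show ?thesis using True chi_eq_0_iff by simp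
next
  case False
  show ?thesis
  proof (cases "\<exists>y. [y\<^sup>2 = x] (mod int p)")
    case True
    then obtain y0 where y0: "[y0\<^sup>2 = x] (mod int p)" by blast
    define y where "y = y0 mod int p"
    have y: "[y\<^sup>2 = x] (mod int p)"
      using y0 unfolding y_def by (simp add: cong_def power_mod)
    have yR: "y \<in> R" by (simp add: y_def)
    have ny: "\<not> int p dvd y"
      using False y dvd_power2_iff cong_dvd_iff by blast
    define y' where "y' = (- y) mod int p"
    have y'R: "y' \<in> R" by (simp add: y'_def)
    have f1: "[z\<^sup>2 = x] (mod int p) \<longleftrightarrow> [z = y] (mod int p) \<or> [z = y'] (mod int p)" for z
    proof -
      have "[z\<^sup>2 = x] (mod int p) \<longleftrightarrow> [z\<^sup>2 = y\<^sup>2] (mod int p)"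
        using y by (meson cong_sym cong_trans)
      moreover have "[z = - y] (mod int p) \<longleftrightarrow> [z = y'] (mod int p)"
        by (simp add: y'_def)
      ultimately show ?thesis
        by (simp only: cong_power2_iff)
    qed
    have f2: "z \<in> R \<and> [z = w] (mod int p) \<longleftrightarrow> z = w" if "w \<in> R" for z w
      using that R_cong_iff cong_refl by metis
    have "{z\<in>R. [z\<^sup>2 = x] (mod int p)} = {y, y'}"
      unfolding f1 using f2[OF yR] f2[OF y'R] by blast
    moreover have "y \<noteq> y'"
    proof
      assume "y = y'"
      then have "[y = - y] (mod int p)" by (metis y'_def cong_def mod_mod_trivial)
      then have "int p dvd 2 * y" by (simp add: cong_iff_dvd_diff)
      then have "int p dvd 2 \<or> int p dvd y"
        using prime_int_p prime_dvd_mult_iff by blast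
      then show False
        using ny p_gt_3 not_dvd_small[of 2] by simp
    qed
    moreover have "chi x = 1"
      using y ny chi_cong[OF y] chi_power2 by simp
    ultimately show ?thesis by simp
  next
    case F: False
    then have "chi x = -1"
      using False by (simp add: chi_def Legendre_def QuadRes_def cong_0_iff)
    moreover have "{z\<in>R. [z\<^sup>2 = x] (mod int p)} = {}" using F by blast
    ultimately show ?thesis by simp
  qed
qed

text \<open>Group the z by the residue of their square; \<open>card_sqrt\<close> gives the size of
  each fibre.\<close>

lemma sum_power2:
  fixes F :: "int \<Rightarrow> int"
  assumes "periodic F"
  shows "(\<Sum>z\<in>R. F (z\<^sup>2)) = (\<Sum>x\<in>R. (1 + chi x) * F x)"
proof -
  have "(\<Sum>z\<in>R. F (z\<^sup>2)) = (\<Sum>z\<in>R. F (z\<^sup>2 mod int p))"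
    using assms by (intro sum.cong) (auto simp: periodic_def)
  also have "\<dots> = (\<Sum>x\<in>R. \<Sum>z | z \<in> R \<and> z\<^sup>2 mod int p = x. F (z\<^sup>2 mod int p))"
    by (subst sum.group) auto
  also have "\<dots> = (\<Sum>x\<in>R. (1 + chi x) * F x)"
  proof (rule sum.cong)
    fix x assume x: "x \<in> R"
    have "{z \<in> R. z\<^sup>2 mod int p = x} = {z\<in>R. [z\<^sup>2 = x] (mod int p)}"
      using x by (auto simp: R_def cong_def)
    moreover have "(\<Sum>z | z \<in> R \<and> z\<^sup>2 mod int p = x. F (z\<^sup>2 mod int p))
        = (\<Sum>z | z \<in> R \<and> z\<^sup>2 mod int p = x. F x)"
      by (intro sum.cong) auto
    ultimately show "(\<Sum>z | z \<in> R \<and> z\<^sup>2 mod int p = x. F (z\<^sup>2 mod int p)) = (1 + chi x) * F x"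
      using card_sqrt[of x] by simp
  qed simp
  finally show ?thesis .
qed

section \<open>Linear, quadratic and averaged cubic character sums\<close>

lemma sum_chi: "(\<Sum>x\<in>R. chi x) = 0"
proof -
  \<comment> \<open>With the constant function 1, the substitution of squares counts
    \<open>R\<close> in two ways, and the difference is the sum of \<open>chi\<close>.\<close>
  have "(\<Sum>z\<in>R. (1::int)) = (\<Sum>x\<in>R. (1 + chi x) * 1)"
    using sum_power2[of "\<lambda>_. 1"] by (simp add: periodic_def)
  then show ?thesis by (simp add: sum.distrib)
qed

lemma sum_chi_affine: "\<not> int p dvd m \<Longrightarrow> (\<Sum>x\<in>R. chi (m * x + d)) = 0"
  using sum_affine[OF periodic_chi] sum_chi by simp

text \<open>Scaling x by D shows that the sum \<open>J D\<close> is the same for all D prime to p.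
  Over all D the sums add up to 0, because for fixed x the sum over D is linear. Since
  \<open>J 0\<close> is p - 1, this leaves (p - 1)(\<open>J 1\<close> + 1) = 0.\<close>

lemma sum_chi_mult_shift:
  assumes "\<not> int p dvd D"
  shows "(\<Sum>x\<in>R. chi (x * (x + D))) = -1"
proof -
  define J where "J D = (\<Sum>x\<in>R. chi (x * (x + D)))" for D
  have per: "periodic (\<lambda>x. chi (x * (x + D)))" for D
    unfolding periodic_def by (intro allI impI chi_cong cong_mult cong_add cong_refl)
  have J: "J D = J 1" if "\<not> int p dvd D" for D
  proof -
    have "J D = (\<Sum>x\<in>R. chi ((D * x + 0) * ((D * x + 0) + D)))"
      unfolding J_def by (rule sum_affine[OF per that, symmetric])
    also have "\<dots> = (\<Sum>x\<in>R. chi (D\<^sup>2) * chi (x * (x + 1)))"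
      by (simp add: chi_mult [symmetric] algebra_simps power2_eq_square)
    also have "\<dots> = J 1"
      unfolding J_def using that chi_power2 by simp
    finally show ?thesis .
  qed
  have "(\<Sum>D\<in>R. J D) = (\<Sum>x\<in>R. chi x * (\<Sum>D\<in>R. chi (1 * D + x)))"
    unfolding J_def by (subst sum.swap) (simp add: chi_mult sum_distrib_left add.commute)
  also have "\<dots> = 0"
    by (simp only: sum_chi_affine[OF not_dvd_1] mult_zero_right sum.neutral_const)
  finally have "(\<Sum>D\<in>R. J D) = 0" .
  moreover have "(\<Sum>D\<in>R. J D) = J 0 + (\<Sum>D\<in>R - {0}. J D)"
    using p_gt_3 by (subst sum.remove[of R 0]) (auto simp: R_def)
  moreover have "(\<Sum>D\<in>R - {0}. J D) = (\<Sum>D\<in>R - {0}. J 1)"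
    by (intro sum.cong J refl not_dvd_small) (auto simp: R_def)
  moreover have "card (R - {0}) = p - 1"
    using p_gt_3 by (simp add: R_def)
  moreover have "J 0 = int p - 1"
  proof -
    have "chi (x * (x + 0)) = 1" if "x \<in> R - {0}" for x
      using not_dvd_small[of x] chi_power2[of x] that by (auto simp: R_def power2_eq_square)
    moreover have "chi 0 = 0"
      by (simp add: chi_eq_0_iff)
    ultimately have "J 0 = (\<Sum>x\<in>R - {0}. 1)"
      unfolding J_def by (intro sum.mono_neutral_cong_right) auto
    then show ?thesis using \<open>card (R - {0}) = p - 1\<close> p_gt_3 by simp
  qed
  ultimately have "(int p - 1) * (J 1 + 1) = 0"
    using p_gt_3 by (simp add: algebra_simps of_nat_diff)
  then have "J 1 = -1" using p_gt_3 by auto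
  then show ?thesis using J[OF assms] by (simp add: J_def)
qed

text \<open>Averaging over the shifts of the cubic by multiples of the monic cubic vanishing
  at the y's makes the factor at z run over a complete residue system.\<close>

lemma sum_cubics_unique_point:
  assumes nz: "\<not> int p dvd z - y1" "\<not> int p dvd z - y2" "\<not> int p dvd z - y3"
  defines "f \<equiv> \<lambda>c0 c1 c2 c3 x. chi (c0 + c1 * x + c2 * x\<^sup>2 + c3 * x^3)"
  shows "(\<Sum>c3\<in>R. \<Sum>c2\<in>R. \<Sum>c1\<in>R. \<Sum>c0\<in>R.
      f c0 c1 c2 c3 y1 * f c0 c1 c2 c3 y2 * f c0 c1 c2 c3 y3 * f c0 c1 c2 c3 z) = 0"
    (is "?L = 0")
proof -
  define G where "G c0 c1 c2 c3 =
    f c0 c1 c2 c3 y1 * f c0 c1 c2 c3 y2 * f c0 c1 c2 c3 y3 * f c0 c1 c2 c3 z" for c0 c1 c2 c3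
  \<comment> \<open>The lower coefficients of (x - y1)(x - y2)(x - y3); \<open>g\<close> is the
    value of this cubic at z, a unit mod p.\<close>
  define e1 e2 e3 where "e1 = - (y1 + y2 + y3)" and "e2 = y1 * y2 + y1 * y3 + y2 * y3"
    and "e3 = - (y1 * y2 * y3)"
  define g where "g = (z - y1) * (z - y2) * (z - y3)"
  have g: "\<not> int p dvd g"
    unfolding g_def using nz prime_int_p by (simp add: prime_dvd_mult_iff)
  have fper: "periodic (\<lambda>c0. f c0 c1 c2 c3 x)" "periodic (\<lambda>c1. f c0 c1 c2 c3 x)"
    "periodic (\<lambda>c2. f c0 c1 c2 c3 x)" for c0 c1 c2 c3 x
    unfolding periodic_def f_def
    by (intro allI impI chi_cong cong_add cong_mult cong_refl; assumption)+
  have Gper: "periodic (\<lambda>c0. G c0 c1 c2 c3)" "periodic (\<lambda>c1. G c0 c1 c2 c3)"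
    "periodic (\<lambda>c2. G c0 c1 c2 c3)" for c0 c1 c2 c3
    unfolding G_def using fper[unfolded periodic_def]
    by (auto simp: periodic_def)
  have sper: "periodic (\<lambda>x. \<Sum>a\<in>R. H a x)" if "\<And>a. periodic (H a)"
    for H :: "int \<Rightarrow> int \<Rightarrow> int"
    using that unfolding periodic_def by (auto intro!: sum.cong)
  have s1: "(\<Sum>c2\<in>R. \<Sum>c1\<in>R. \<Sum>c0\<in>R. G (c0 + c3 * e3) (c1 + c3 * e2) (c2 + c3 * e1) c3)
        = (\<Sum>c2\<in>R. \<Sum>c1\<in>R. \<Sum>c0\<in>R. G c0 c1 c2 c3)" for c3
  proof -
    have "(\<Sum>c2\<in>R. \<Sum>c1\<in>R. \<Sum>c0\<in>R. G (c0 + c3 * e3) (c1 + c3 * e2) (c2 + c3 * e1) c3)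
      = (\<Sum>c2\<in>R. \<Sum>c1\<in>R. \<Sum>c0\<in>R. G c0 (c1 + c3 * e2) (c2 + c3 * e1) c3)"
      by (rule sum.cong[OF refl], rule sum.cong[OF refl], rule sum_shift, rule Gper)
    also have "\<dots> = (\<Sum>c2\<in>R. \<Sum>c1\<in>R. \<Sum>c0\<in>R. G c0 c1 (c2 + c3 * e1) c3)"
      by (rule sum.cong[OF refl], rule sum_shift[of "\<lambda>c1. \<Sum>c0\<in>R. G c0 c1 _ c3"],
          rule sper, rule Gper)
    also have "\<dots> = (\<Sum>c2\<in>R. \<Sum>c1\<in>R. \<Sum>c0\<in>R. G c0 c1 c2 c3)"
      by (rule sum_shift[of "\<lambda>c2. \<Sum>c1\<in>R. \<Sum>c0\<in>R. G c0 c1 c2 c3"],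
          rule sper, rule sper, rule Gper)
    finally show ?thesis .
  qed
  \<comment> \<open>After the shift the cubic is \<open>q\<close> plus c3 times (x - y1)(x - y2)(x -
    y3). At the y's the variable c3 disappears, while at z it occurs linearly with slope
    \<open>g\<close>, so the sum over c3 is taken innermost.\<close>
  define q where "q c0 c1 c2 x = c0 + c1 * x + c2 * x\<^sup>2" for c0 c1 c2 x :: int
  have s2: "G (c0 + c3 * e3) (c1 + c3 * e2) (c2 + c3 * e1) c3
      = chi (q c0 c1 c2 y1) * chi (q c0 c1 c2 y2) * chi (q c0 c1 c2 y3)
        * chi (g * c3 + q c0 c1 c2 z)" for c0 c1 c2 c3
  proof -
    have e: "c0 + c3 * e3 + (c1 + c3 * e2) * x + (c2 + c3 * e1) * x\<^sup>2 + c3 * x^3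
      = q c0 c1 c2 x + c3 * ((x - y1) * (x - y2) * (x - y3))" for x
      unfolding q_def e1_def e2_def e3_def
      by (simp add: algebra_simps power2_eq_square power3_eq_cube)
    show ?thesis
      unfolding G_def f_def e by (simp add: g_def ac_simps)
  qed
  have "?L = (\<Sum>c3\<in>R. \<Sum>c2\<in>R. \<Sum>c1\<in>R. \<Sum>c0\<in>R. G c0 c1 c2 c3)"
    by (simp add: G_def)
  also have "\<dots> = (\<Sum>c3\<in>R. \<Sum>c2\<in>R. \<Sum>c1\<in>R. \<Sum>c0\<in>R.
        G (c0 + c3 * e3) (c1 + c3 * e2) (c2 + c3 * e1) c3)"
    by (simp only: s1)
  also have "\<dots> = (\<Sum>c2\<in>R. \<Sum>c1\<in>R. \<Sum>c0\<in>R. \<Sum>c3\<in>R.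
        G (c0 + c3 * e3) (c1 + c3 * e2) (c2 + c3 * e1) c3)"
    by (subst sum.swap, rule sum.cong[OF refl], subst sum.swap, rule sum.cong[OF refl],
        rule sum.swap)
  also have "\<dots> = 0"
    unfolding s2 sum_distrib_left[symmetric] by (simp add: sum_chi_affine[OF g])
  finally show ?thesis .
qed

subsection \<open>Fourth moment of cubic character sums\<close>

text \<open>Expand the fourth power and sum over the coefficients first. A quadruple of points in
  which some point differs from the other three contributes 0. In the remaining quadruples the
  points coincide in pairs, so there are at most 3 p^2 of them, each contributing at most the number
  p^4 of cubics.\<close>

lemma cubic_fourth_moment:
  defines "f \<equiv> \<lambda>(c3, c2, c1, c0) x. chi (c0 + c1 * x + c2 * x\<^sup>2 + c3 * x^3)"
  shows "(\<Sum>c\<in>R \<times> R \<times> R \<times> R. (\<Sum>x\<in>R. f c x)^4) \<le> 3 * int p ^ 6"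
proof -
  let ?C = "R \<times> R \<times> R \<times> R"
  define T where "T = (\<lambda>(x1, x2, x3, x4). \<Sum>c\<in>?C. f c x1 * f c x2 * f c x3 * f c x4)"
  have expand: "(\<Sum>x\<in>R. g x)^4 = (\<Sum>(x1, x2, x3, x4)\<in>?C. g x1 * g x2 * g x3 * g x4)"
    for g :: "int \<Rightarrow> int"
    by (simp add: power4_eq_xxxx sum_product sum.cartesian_product[symmetric]
        sum_distrib_left sum_distrib_right mult.assoc mult.commute mult.left_commute)
  have "(\<Sum>c\<in>?C. (\<Sum>x\<in>R. f c x)^4) = (\<Sum>t\<in>?C. T t)"
    unfolding expand T_def by (subst sum.swap) (simp add: case_prod_unfold)
  have nested: "(\<Sum>c\<in>?C. g c) = (\<Sum>c3\<in>R. \<Sum>c2\<in>R. \<Sum>c1\<in>R. \<Sum>c0\<in>R. g (c3, c2, c1, c0))"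
    for g :: "int \<times> int \<times> int \<times> int \<Rightarrow> int"
    by (simp add: sum.cartesian_product case_prod_unfold)
  \<comment> \<open>The points x1, x2, x3 may coincide; only z has to be different from each of
    them.\<close>
  have zero: "(\<Sum>c\<in>?C. f c x1 * f c x2 * f c x3 * f c z) = 0"
    if "x1 \<in> R" "x2 \<in> R" "x3 \<in> R" "z \<in> R" "z \<noteq> x1" "z \<noteq> x2" "z \<noteq> x3" for x1 x2 x3 z
  proof -
    have "\<not> int p dvd z - y" if "y \<in> R" "z \<noteq> y" for y
      using that \<open>z \<in> R\<close> R_cong_iff[of z y] by (simp add: cong_iff_dvd_diff)
    from sum_cubics_unique_point[OF this this this] that show ?thesis
      by (simp add: f_def nested)
  qed
  \<comment> \<open>One image for each of the three ways to pair four positions. The images overlap,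
    so 3 p^2 is only an upper bound for the size.\<close>
  define D where "D = (\<lambda>(x, y). (x, x, y, y)) ` (R \<times> R) \<union> (\<lambda>(x, y). (x, y, x, y)) ` (R \<times> R)
      \<union> (\<lambda>(x, y). (x, y, y, x)) ` (R \<times> R)"
  have "T t = 0" if t: "t \<in> ?C - D" for t
  proof -
    obtain x1 x2 x3 x4 where tt: "t = (x1, x2, x3, x4)" by (cases t)
    have x: "x1 \<in> R" "x2 \<in> R" "x3 \<in> R" "x4 \<in> R" using t tt by auto
    have "(x1, x2, x3, x4) \<notin> D" using t tt by simp
    then have ne: "\<not> (x1 = x2 \<and> x3 = x4)" "\<not> (x1 = x3 \<and> x2 = x4)" "\<not> (x1 = x4 \<and> x2 = x3)"
      unfolding D_def using x by auto
    consider "x4 \<noteq> x1 \<and> x4 \<noteq> x2 \<and> x4 \<noteq> x3" | "x3 \<noteq> x1 \<and> x3 \<noteq> x2 \<and> x3 \<noteq> x4"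
      | "x2 \<noteq> x1 \<and> x2 \<noteq> x3 \<and> x2 \<noteq> x4" | "x1 \<noteq> x2 \<and> x1 \<noteq> x3 \<and> x1 \<noteq> x4"
      using ne by metis
    then show ?thesis
    proof cases
      case 1
      then show ?thesis using zero[of x1 x2 x3 x4] x by (simp add: T_def tt)
    next
      case 2
      then show ?thesis using zero[of x1 x2 x4 x3] x by (simp add: T_def tt ac_simps)
    next
      case 3
      then show ?thesis using zero[of x1 x3 x4 x2] x by (simp add: T_def tt ac_simps)
    next
      case 4
      then show ?thesis using zero[of x2 x3 x4 x1] x by (simp add: T_def tt ac_simps)
    qed
  qed
  moreover have "D \<subseteq> ?C" by (auto simp: D_def)
  ultimately have "(\<Sum>t\<in>?C. T t) = (\<Sum>t\<in>D. T t)"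
    by (intro sum.mono_neutral_right) auto
  also have "\<dots> \<le> (\<Sum>t\<in>D. int p ^ 4)"
  proof (rule sum_mono)
    fix t
    have "T t \<le> (\<Sum>c\<in>?C. 1)" for t
    proof -
      have "chi a * chi b * chi c * chi d \<le> 1" for a b c d
        using chi_cases[of a] chi_cases[of b] chi_cases[of c] chi_cases[of d] by auto
      then show ?thesis
        unfolding T_def f_def case_prod_unfold by (intro sum_mono)
    qed
    then show "T t \<le> int p ^ 4"
      by (simp add: card_cartesian_product power4_eq_xxxx mult.assoc)
  qed
  also have "\<dots> \<le> 3 * int p ^ 6"
  proof -
    have "card (g ` (R \<times> R)) \<le> p\<^sup>2" for g :: "int \<times> int \<Rightarrow> int \<times> int \<times> int \<times> int"
      using card_image_le[of "R \<times> R" g] by (simp add: card_cartesian_product power2_eq_square)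
    then have "card D \<le> p\<^sup>2 + p\<^sup>2 + p\<^sup>2"
      unfolding D_def by (meson add_mono card_Un_le order_trans)
    then have "int (card D) \<le> int (3 * p\<^sup>2)"
      by linarith
    then have "int (card D) * int p ^ 4 \<le> int (3 * p\<^sup>2) * int p ^ 4"
      by (intro mult_right_mono) auto
    then show ?thesis by (simp add: power_add[symmetric] mult.assoc)
  qed
  finally show ?thesis using \<open>_ = (\<Sum>t\<in>?C. T t)\<close> by simp
qed

text \<open>\<open>h\<close> lists the coefficients, leading one first, of c (x - r)(x - r - a A)(x
  - r - a B). The leading coefficient recovers c. With \<open>e1\<close>, \<open>e2\<close> the
  elementary symmetric functions of the roots, e1^2 - 3 e2 is invariant under translation and equals
  (A^2 - A B + B^2) a^2, which recovers a up to sign; a <= (p - 1) / 2 fixes the sign. Then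
  \<open>e1\<close> recovers r, as 3 is invertible.\<close>

lemma cubic_family_inj:
  assumes nz: "\<not> int p dvd A\<^sup>2 - A * B + B\<^sup>2"
  defines "h \<equiv> \<lambda>(c, a, r). (c mod int p, - (c * (3 * r + a * (A + B))) mod int p,
      c * (3 * r\<^sup>2 + 2 * r * (a * (A + B)) + a\<^sup>2 * (A * B)) mod int p,
      - (c * (r * (r + a * A) * (r + a * B))) mod int p)"
  shows "inj_on h ({1..<int p} \<times> {1..int ((p - 1) div 2)} \<times> R)"
proof (rule inj_onI)
  fix t t'
  assume t: "t \<in> {1..<int p} \<times> {1..int ((p - 1) div 2)} \<times> R"
    "t' \<in> {1..<int p} \<times> {1..int ((p - 1) div 2)} \<times> R" and ht: "h t = h t'"
  obtain c a r c' a' r' where tt: "t = (c, a, r)" "t' = (c', a', r')"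
    by (cases t, cases t')
  have c: "c \<in> {1..<int p}" "c' \<in> {1..<int p}"
    and a: "a \<in> {1..int ((p - 1) div 2)}" "a' \<in> {1..int ((p - 1) div 2)}"
    and r: "r \<in> R" "r' \<in> R" and eq: "h (c, a, r) = h (c', a', r')"
    using t ht unfolding tt by auto
  have "c' = c" using eq c by (simp add: h_def)
  have nc: "\<not> int p dvd c" using c not_dvd_small[of c] by simp
  define e1 e2 where "e1 = (\<lambda>a r. 3 * r + a * (A + B))"
    and "e2 = (\<lambda>a r. 3 * r\<^sup>2 + 2 * r * (a * (A + B)) + a\<^sup>2 * (A * B))"
  have "[- (c * e1 a r) = - (c * e1 a' r')] (mod int p)" and c2: "[c * e2 a r = c * e2 a' r'] (mod int p)"
    using eq unfolding h_def cong_def \<open>c' = c\<close> e1_def e2_def by auto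
  then have "[c * e1 a r = c * e1 a' r'] (mod int p)"
    using cong_minus_minus_iff by blast
  with c2 nc have e: "[e1 a r = e1 a' r'] (mod int p)" "[e2 a r = e2 a' r'] (mod int p)"
    using cong_mult_left_iff by blast+
  have "[(e1 a r)\<^sup>2 - 3 * e2 a r = (e1 a' r')\<^sup>2 - 3 * e2 a' r'] (mod int p)"
    by (intro cong_diff cong_pow cong_mult cong_refl e)
  moreover have "(e1 a r)\<^sup>2 - 3 * e2 a r = (A\<^sup>2 - A * B + B\<^sup>2) * a\<^sup>2" for a r
    unfolding e1_def e2_def by (simp add: algebra_simps power2_eq_square)
  ultimately have "[a\<^sup>2 = a'\<^sup>2] (mod int p)"
    using nz cong_mult_left_iff by simp
  then have "int p dvd a - a' \<or> int p dvd a + a'"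
    using cong_power2_iff by (simp add: cong_iff_dvd_diff)
  then have "a = a'"
  proof
    assume "int p dvd a - a'"
    moreover have "\<bar>a - a'\<bar> < int p" using a by auto
    ultimately show ?thesis using zdvd_not_zless[of "\<bar>a - a'\<bar>" "int p"] by auto
  next
    assume "int p dvd a + a'"
    moreover have "a + a' < int p" "0 < a + a'" using a p_gt_3 by auto
    ultimately show ?thesis using not_dvd_small by blast
  qed
  moreover have "[3 * r = 3 * r'] (mod int p)"
    using e(1) \<open>a = a'\<close> by (simp add: e1_def cong_add_rcancel)
  then have "r = r'"
    using cong_mult_left_iff[of 3 r r'] not_dvd_small[of 3] p_gt_3 R_cong_iff[OF r] by simp
  ultimately show "t = t'" using \<open>c' = c\<close> tt by simp
qed

text \<open>The sum takes the same absolute value on an orbit of about p^3/2 of the p^4 cubics, so the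
  fourth moment forces it to be o(p).\<close>

lemma cubic_sum_bound:
  assumes nz: "\<not> int p dvd A\<^sup>2 - A * B + B\<^sup>2"
  shows "(\<Sum>x\<in>R. chi (x * (x - A) * (x - B)))^4 \<le> 24 * int p ^ 3"
proof -
  define S where "S = (\<Sum>x\<in>R. chi (x * (x - A) * (x - B)))"
  let ?I = "{1..<int p} \<times> {1..int ((p - 1) div 2)} \<times> R"
  let ?C = "R \<times> R \<times> R \<times> R"
  define h where "h = (\<lambda>(c, a, r). (c mod int p, - (c * (3 * r + a * (A + B))) mod int p,
      c * (3 * r\<^sup>2 + 2 * r * (a * (A + B)) + a\<^sup>2 * (A * B)) mod int p,
      - (c * (r * (r + a * A) * (r + a * B))) mod int p))"
  define f where "f = (\<lambda>(c3, c2, c1, c0) x. chi (c0 + c1 * x + c2 * x\<^sup>2 + c3 * x^3))"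
  have inj: "inj_on h ?I"
    using cubic_family_inj[OF nz] unfolding h_def .
  \<comment> \<open>Translating by r leaves the sum unchanged, c contributes the factor
    \<open>chi c\<close>, and scaling x by a contributes \<open>chi a ^ 3\<close>. These are signs,
    which the fourth power removes.\<close>
  have S: "(\<Sum>x\<in>R. f (h t) x)^4 = S^4" if t: "t \<in> ?I" for t
  proof -
    obtain c a r where tt: "t = (c, a, r)" by (cases t)
    have "int ((p - 1) div 2) < int p"
      using p_gt_3 by auto
    then have nc: "\<not> int p dvd c" and na: "\<not> int p dvd a"
      using t tt not_dvd_small[of c] not_dvd_small[of a] by auto
    define F where "F x = chi (x * (x - a * A) * (x - a * B))" for x
    have "periodic F"
      unfolding periodic_def F_def
      by (intro allI impI chi_cong cong_mult cong_diff cong_refl)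
    have "f (h t) x = chi c * F (x + (- r))" for x
    proof -
      have "f (h t) x = chi (- (c * (r * (r + a * A) * (r + a * B)))
          + c * (3 * r\<^sup>2 + 2 * r * (a * (A + B)) + a\<^sup>2 * (A * B)) * x
          + - (c * (3 * r + a * (A + B))) * x\<^sup>2 + c * x^3)"
        unfolding f_def h_def tt prod.case
        by (intro chi_cong cong_add cong_mult cong_refl) (simp_all add: cong_def)
      also have "\<dots> = chi (c * ((x + (- r)) * ((x + (- r)) - a * A) * ((x + (- r)) - a * B)))"
        by (rule arg_cong[where f = chi])
          (simp add: algebra_simps power2_eq_square power3_eq_cube)
      finally show ?thesis by (simp add: F_def chi_mult)
    qed
    then have "(\<Sum>x\<in>R. f (h t) x) = chi c * (\<Sum>x\<in>R. F x)"
      by (simp only: sum_distrib_left[symmetric] sum_shift[OF \<open>periodic F\<close>])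
    also have "(\<Sum>x\<in>R. F x) = (\<Sum>x\<in>R. F (a * x + 0))"
      by (rule sum_affine[OF \<open>periodic F\<close> na, symmetric])
    also have "\<dots> = (\<Sum>x\<in>R. chi a ^ 3 * chi (x * (x - A) * (x - B)))"
    proof (rule sum.cong[OF refl])
      fix x
      have "(a * x + 0) * ((a * x + 0) - a * A) * ((a * x + 0) - a * B)
          = a * a * a * (x * (x - A) * (x - B))"
        by (simp add: algebra_simps)
      then show "F (a * x + 0) = chi a ^ 3 * chi (x * (x - A) * (x - B))"
        by (simp only: F_def chi_mult power3_eq_cube)
    qed
    also have "\<dots> = chi a ^ 3 * S"
      by (simp add: S_def sum_distrib_left)
    finally have "(\<Sum>x\<in>R. f (h t) x) = chi c * (chi a ^ 3 * S)" .
    then show ?thesis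
      using chi_cases[of c] chi_cases[of a] chi_eq_0_iff[of c] chi_eq_0_iff[of a] nc na by auto
  qed
  have "int (card ?I) * S^4 = (\<Sum>t\<in>?I. (\<Sum>x\<in>R. f (h t) x)^4)"
    by (simp add: S)
  also have "\<dots> = (\<Sum>c\<in>h ` ?I. (\<Sum>x\<in>R. f c x)^4)"
    by (simp only: sum.reindex[OF inj] o_def)
  also have "\<dots> \<le> (\<Sum>c\<in>?C. (\<Sum>x\<in>R. f c x)^4)"
  proof (rule sum_mono2)
    have "h t \<in> ?C" for t
      by (simp add: h_def split: prod.split)
    then show "h ` ?I \<subseteq> ?C" by blast
  qed auto
  also have "\<dots> \<le> 3 * int p ^ 6"
    using cubic_fourth_moment unfolding f_def .
  finally have *: "int (card ?I) * S^4 \<le> 3 * int p ^ 6" .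
  \<comment> \<open>Since p is odd, the orbit has exactly (p - 1)^2 p / 2 elements.\<close>
  have "odd p" using prime_p p_gt_3 prime_odd_nat by auto
  then have half: "2 * int ((p - 1) div 2) = int p - 1"
    using p_gt_3 by (auto elim!: oddE)
  have "int (card ?I) = (int p - 1) * (int ((p - 1) div 2) * int p)"
    using p_gt_3 by (simp add: card_cartesian_product of_nat_diff)
  then have "2 * int (card ?I) = (int p - 1) * ((2 * int ((p - 1) div 2)) * int p)"
    by simp
  then have "2 * int (card ?I) = (int p - 1)\<^sup>2 * int p"
    unfolding half by (simp add: power2_eq_square)
  moreover have "(2 * int (card ?I)) * S^4 \<le> 6 * int p ^ 6"
    using * by (simp only: mult.assoc)
  ultimately have "(int p - 1)\<^sup>2 * int p * S^4 \<le> 6 * int p ^ 6"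
    by (simp only:)
  then have "int p * ((int p - 1)\<^sup>2 * S^4) \<le> int p * (6 * int p ^ 5)"
    by (simp add: algebra_simps eval_nat_numeral)
  then have b: "(int p - 1)\<^sup>2 * S^4 \<le> 6 * int p ^ 5"
    using p_gt_3 by (simp add: mult_le_cancel_left)
  \<comment> \<open>Replacing (p - 1)^2 by p^2 costs a factor 4, which makes 24 out of 6.\<close>
  have "(int p)\<^sup>2 \<le> (2 * (int p - 1))\<^sup>2"
    using p_gt_3 by (intro power_mono) auto
  then have "(int p)\<^sup>2 * S^4 \<le> (2 * (int p - 1))\<^sup>2 * S^4"
    by (intro mult_right_mono) auto
  also have "\<dots> \<le> (int p)\<^sup>2 * (24 * int p ^ 3)"
    using b by (simp add: power_mult_distrib eval_nat_numeral algebra_simps)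
  finally show ?thesis
    using p_gt_3 unfolding S_def[symmetric] by (simp add: mult_le_cancel_left)
qed

end

subsection \<open>Choice of the shift\<close>

text \<open>Cauchy-Schwarz against the constant 1, kept in the integers: the difference of the two
  sides is half the double sum of (f x - f y)^2.\<close>

lemma sum_power2_le_card_mult:
  fixes f :: "'a \<Rightarrow> int"
  shows "(\<Sum>x\<in>W. f x)\<^sup>2 \<le> int (card W) * (\<Sum>x\<in>W. (f x)\<^sup>2)"
proof -
  have "0 \<le> (\<Sum>x\<in>W. \<Sum>y\<in>W. (f x - f y)\<^sup>2)"
    by (intro sum_nonneg) auto
  also have "\<dots> = (\<Sum>x\<in>W. \<Sum>y\<in>W. (f x)\<^sup>2 + (f y)\<^sup>2 - 2 * (f x * f y))"
    by (simp add: power2_diff mult.assoc)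
  also have "\<dots> = 2 * (int (card W) * (\<Sum>x\<in>W. (f x)\<^sup>2)) - 2 * (\<Sum>x\<in>W. f x)\<^sup>2"
    by (simp add: sum.distrib sum_subtractf sum_distrib_left[symmetric]
        sum_distrib_right[symmetric] sum_product[symmetric] power2_eq_square)
  finally show ?thesis by simp
qed

section \<open>Second moment of the correlations over all shifts\<close>

context odd_prime_residues
begin

text \<open>Put x = t^2 with weight 1 + \<open>chi x\<close>. The weight 1 leaves a quadratic sum,
  equal to -1 as A and B are distinct mod p; the weight \<open>chi x\<close> gives the cubic
  sum.\<close>

lemma quartic_sum_eq:
  assumes "\<not> int p dvd A - B"
  shows "(\<Sum>t\<in>R. chi ((t\<^sup>2 - A) * (t\<^sup>2 - B)))
    = (\<Sum>x\<in>R. chi (x * (x - A) * (x - B))) - 1"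
proof -
  define F where "F x = chi ((x - A) * (x - B))" for x
  have perF: "periodic F"
    unfolding periodic_def F_def
    by (intro allI impI chi_cong cong_mult cong_diff cong_refl)
  have "(\<Sum>t\<in>R. F (t\<^sup>2)) = (\<Sum>x\<in>R. F x) + (\<Sum>x\<in>R. chi (x * (x - A) * (x - B)))"
    unfolding sum_power2[OF perF]
    by (simp add: F_def chi_mult distrib_right mult.assoc sum.distrib)
  moreover have "(\<Sum>x\<in>R. F x) = (\<Sum>x\<in>R. F (x + A))"
    by (rule sum_shift[OF perF, symmetric])
  moreover have "\<dots> = -1"
    using sum_chi_mult_shift[OF assms] by (simp add: F_def algebra_simps)
  ultimately show ?thesis by (simp add: F_def)
qed

text \<open>Centring uses 4 (t + i)(t + j) = (2 t + i + j)^2 - (i - j)^2. Both pairs have the same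
  centre because their sums agree, so one substitution for 2 t + i + j serves both; the factors 4
  are squares.\<close>

lemma additive_quadruple_sum:
  assumes "i + j = i' + j'"
  shows "(\<Sum>t\<in>R. chi (t + i) * chi (t + j) * (chi (t + i') * chi (t + j')))
    = (\<Sum>t\<in>R. chi ((t\<^sup>2 - (i - j)\<^sup>2) * (t\<^sup>2 - (i' - j')\<^sup>2)))"
proof -
  define F where "F t = chi ((t\<^sup>2 - (i - j)\<^sup>2) * (t\<^sup>2 - (i' - j')\<^sup>2))" for t
  have perF: "periodic F"
    unfolding periodic_def F_def
    by (intro allI impI chi_cong cong_mult cong_diff cong_pow cong_refl)
  have n2: "\<not> int p dvd 2" "\<not> int p dvd 4"
    using not_dvd_small[of 2] not_dvd_small[of "2\<^sup>2"] p_gt_3 dvd_power2_iff[of 2] by auto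
  have "chi (t + i) * chi (t + j) * (chi (t + i') * chi (t + j')) = F (2 * t + (i + j))" for t
  proof -
    have "(2 * t + (i + j))\<^sup>2 - (i - j)\<^sup>2 = 4 * ((t + i) * (t + j))"
      by (simp add: power2_eq_square algebra_simps)
    moreover have "(2 * t + (i + j))\<^sup>2 - (i' - j')\<^sup>2 = 4 * ((t + i') * (t + j'))"
      unfolding assms by (simp add: power2_eq_square algebra_simps)
    moreover have "chi 4 * chi 4 = 1"
      using chi_power2[OF n2(2)] by (simp only: power2_eq_square chi_mult)
    moreover have "chi a * chi b * (chi c * chi d) = (chi 4 * chi 4) * (chi a * chi b * (chi c * chi d))"
      if "chi 4 * chi 4 = 1" for a b c d
      using that by simp
    ultimately show ?thesis by (simp only: F_def chi_mult ac_simps)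
  qed
  then have "(\<Sum>t\<in>R. chi (t + i) * chi (t + j) * (chi (t + i') * chi (t + j')))
      = (\<Sum>t\<in>R. F (2 * t + (i + j)))"
    by simp
  also have "\<dots> = (\<Sum>t\<in>R. F t)"
    by (rule sum_affine[OF perF n2(1)])
  finally show ?thesis by (simp add: F_def)
qed

text \<open>The sum C_w of the overview for u = t + i and v = t + j, indexed by i + j, that is, by u
  + v - 2 t.\<close>

definition corr :: "nat \<Rightarrow> int \<Rightarrow> int \<Rightarrow> int" where
  "corr k t w = (\<Sum>(i, j) | (i, j) \<in> {1..int k} \<times> {1..int k} \<and> i + j = w. chi (t + i) * chi (t + j))"

text \<open>The o(p) estimate in integer form, with 1/N in the role of epsilon: N^4 times the bound
  24 p^3 is at most p^4.\<close>

lemma cubic_sum_small: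
  assumes N: "N > 0" "int p \<ge> 24 * N ^ 4" and nz: "\<not> int p dvd A\<^sup>2 - A * B + B\<^sup>2"
  shows "N * (\<Sum>x\<in>R. chi (x * (x - A) * (x - B))) \<le> int p"
proof -
  define S where "S = (\<Sum>x\<in>R. chi (x * (x - A) * (x - B)))"
  have "(N * S)^4 = N^4 * S^4" by (simp add: power_mult_distrib)
  also have "\<dots> \<le> N^4 * (24 * int p ^ 3)"
    using cubic_sum_bound[OF nz] unfolding S_def by (intro mult_left_mono) auto
  also have "\<dots> = (24 * N^4) * int p ^ 3" by simp
  also have "\<dots> \<le> int p * int p ^ 3"
    using N(2) by (intro mult_right_mono) auto
  also have "\<dots> = int p ^ 4" by (simp add: eval_nat_numeral)
  finally have "(N * S)^4 \<le> int p ^ 4" .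
  then have "\<bar>N * S\<bar> \<le> \<bar>int p\<bar>"
    using power_mono_even power_mono_iff[of "\<bar>N * S\<bar>" "\<bar>int p\<bar>" 4] by (simp add: power_even_abs)
  then show ?thesis unfolding S_def by simp
qed

text \<open>Squaring and summing over w leaves the quadruples with i + j = i' + j'. The trivial
  ones, where the second pair is the first or its swap, number 2 k^2 - k and contribute at most p
  each. Any other contributes at most p / N. The bound p > 2 k^4 keeps the relevant differences
  nonzero mod p, and everything is multiplied by N to avoid division.\<close>

lemma corr_second_moment:
  assumes k: "k > 0" and N: "N > 0" "int p \<ge> 24 * N ^ 4" and p: "int p > 2 * int k ^ 4"
  shows "N * (\<Sum>t\<in>R. \<Sum>w\<in>{2..2 * int k}. (corr k t w)\<^sup>2)
    \<le> N * int p * (2 * int k ^ 2 - int k) + int k ^ 4 * int p"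
proof -
  define K where "K = {1..int k}"
  let ?Q = "K \<times> K"
  have K: "finite K" "card K = k" by (simp_all add: K_def)
  define s where "s q = fst q + snd q" for q :: "int \<times> int"
  define v where "v t q = chi (t + fst q) * chi (t + snd q)" for t and q :: "int \<times> int"
  have corr: "corr k t w = (\<Sum>q\<in>?Q. if s q = w then v t q else 0)" for t w
    unfolding corr_def K_def s_def v_def
    by (subst sum.inter_filter[symmetric]) (auto simp: case_prod_unfold intro!: sum.cong)
  have sq: "(\<Sum>w\<in>{2..2 * int k}. (corr k t w)\<^sup>2)
      = (\<Sum>q\<in>?Q. \<Sum>q'\<in>?Q. if s q = s q' then v t q * v t q' else 0)" for t
  proof -
    have "(\<Sum>w\<in>{2..2 * int k}. (corr k t w)\<^sup>2)
      = (\<Sum>w\<in>{2..2 * int k}. \<Sum>q\<in>?Q. \<Sum>q'\<in>?Q.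
          if w = s q then (if s q = s q' then v t q * v t q' else 0) else 0)"
      unfolding corr power2_eq_square sum_product
      by (intro sum.cong refl) auto
    also have "\<dots> = (\<Sum>q\<in>?Q. \<Sum>q'\<in>?Q. \<Sum>w\<in>{2..2 * int k}.
          if w = s q then (if s q = s q' then v t q * v t q' else 0) else 0)"
      by (subst sum.swap, rule sum.cong[OF refl], rule sum.swap)
    also have "\<dots> = (\<Sum>q\<in>?Q. \<Sum>q'\<in>?Q. if s q = s q' then v t q * v t q' else 0)"
    proof (intro sum.cong refl)
      fix q q' assume "q \<in> ?Q"
      then have "s q \<in> {2..2 * int k}" by (auto simp: s_def K_def)
      then show "(\<Sum>w\<in>{2..2 * int k}. if w = s q then (if s q = s q' then v t q * v t q' else 0) else 0)
          = (if s q = s q' then v t q * v t q' else 0)"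
        by (simp only: sum.delta finite_atLeastAtMost_int) simp
    qed
    finally show ?thesis .
  qed
  define T where "T q q' = (\<Sum>t\<in>R. if s q = s q' then v t q * v t q' else 0)" for q q'
  \<comment> \<open>The error term p is allowed for every pair (q, q'), also the trivial ones; this
    gives the total k^4 p.\<close>
  have bound: "N * T q q' \<le> (if q' \<in> {q, prod.swap q} then N * int p else 0) + int p"
    if q: "q \<in> ?Q" "q' \<in> ?Q" for q q'
  proof (cases "q' \<in> {q, prod.swap q}")
    case True
    have "T q q' \<le> (\<Sum>t\<in>R. 1)"
      unfolding T_def
    proof (rule sum_mono)
      fix t
      have "chi a * chi b * (chi c * chi d) \<le> 1" for a b c d
        using chi_cases[of a] chi_cases[of b] chi_cases[of c] chi_cases[of d] by auto
      then show "(if s q = s q' then v t q * v t q' else 0) \<le> 1"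
        by (simp add: v_def)
    qed
    then have "N * T q q' \<le> N * int p" using N(1) by simp
    then show ?thesis unfolding if_P[OF True] by linarith
  next
    case False
    show ?thesis
    proof (cases "s q = s q'")
      case True
      obtain i j i' j' where ij: "q = (i, j)" "q' = (i', j')" by (cases q, cases q')
      have eq: "i + j = i' + j'" using True by (simp add: s_def ij)
      define A B where "A = (i - j)\<^sup>2" and "B = (i' - j')\<^sup>2"
      have rng: "\<bar>i - j\<bar> \<le> int k" "\<bar>i' - j'\<bar> \<le> int k"
        using q by (auto simp: ij K_def)
      have AB: "0 \<le> A" "A \<le> int k ^ 2" "0 \<le> B" "B \<le> int k ^ 2"
        unfolding A_def B_def using power_mono[OF rng(1), of 2] power_mono[OF rng(2), of 2] by auto
      have "A \<noteq> B"
      proof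
        \<comment> \<open>Equal sums together with differences equal up to sign force q' to be q or
          its swap.\<close>
        assume "A = B"
        then have "i - j = i' - j' \<or> i - j = - (i' - j')"
          unfolding A_def B_def by (simp only: power2_eq_iff)
        then show False using False eq by (auto simp: ij)
      qed
      have kk: "int k ^ 4 = int k ^ 2 * int k ^ 2" by (simp add: power_add[symmetric])
      have k2: "int k ^ 2 \<le> int k ^ 4" using k by (intro power_increasing) auto
      have n1: "\<not> int p dvd A - B"
      proof -
        have "\<not> int p dvd \<bar>A - B\<bar>"
          using \<open>A \<noteq> B\<close> AB p k2 by (intro not_dvd_small) auto
        then show ?thesis by simp
      qed
      have n2: "\<not> int p dvd A\<^sup>2 - A * B + B\<^sup>2"
      proof (rule not_dvd_small)
        \<comment> \<open>In this form the quantity is visibly positive and at most 2 k^4, hence not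
          divisible by p.\<close>
        have e: "A\<^sup>2 - A * B + B\<^sup>2 = (A - B)\<^sup>2 + A * B"
          by (simp add: power2_eq_square algebra_simps)
        have "0 < (A - B)\<^sup>2" using \<open>A \<noteq> B\<close> by simp
        then show "0 < A\<^sup>2 - A * B + B\<^sup>2" unfolding e using AB mult_nonneg_nonneg[of A B] by linarith
        have "(A - B)\<^sup>2 \<le> (int k ^ 2)\<^sup>2"
          using AB by (intro abs_le_square_iff[THEN iffD1]) auto
        moreover have "A * B \<le> int k ^ 2 * int k ^ 2"
          using AB by (intro mult_mono) auto
        ultimately show "A\<^sup>2 - A * B + B\<^sup>2 < int p"
          unfolding e using p kk by (simp add: power2_eq_square)
      qed
      have "T q q' = (\<Sum>x\<in>R. chi (x * (x - A) * (x - B))) - 1"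
        unfolding T_def using additive_quadruple_sum[OF eq] quartic_sum_eq[OF n1] True
        by (simp add: v_def ij A_def B_def)
      then have "N * T q q' = N * (\<Sum>x\<in>R. chi (x * (x - A) * (x - B))) - N"
        by (simp only: right_diff_distrib mult_1_right)
      then show ?thesis
        unfolding if_not_P[OF False] using cubic_sum_small[OF N n2] N(1) by linarith
    next
      case neq: False
      then show ?thesis unfolding if_not_P[OF False] T_def by simp
    qed
  qed
  have card_diag: "(\<Sum>q'\<in>?Q. if q' \<in> {q, prod.swap q} then N * int p else 0)
      = N * int p * (if fst q = snd q then 1 else 2)" if "q \<in> ?Q" for q
  proof -
    have "(\<Sum>q'\<in>?Q. if q' \<in> {q, prod.swap q} then N * int p else 0)
        = (\<Sum>q'\<in>{q, prod.swap q}. N * int p)"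
      using K that by (intro sum.mono_neutral_cong_right) auto
    also have "\<dots> = N * int p * (if fst q = snd q then 1 else 2)"
      by (cases q) auto
    finally show ?thesis .
  qed
  have diag: "(\<Sum>q\<in>?Q. (if fst q = snd q then 1 else 2 :: int)) = 2 * int k ^ 2 - int k"
  proof -
    have "(\<Sum>q\<in>?Q. (if fst q = snd q then 1 else 2 :: int))
        = (\<Sum>i\<in>K. \<Sum>j\<in>K. 2 - (if i = j then 1 else 0))"
      unfolding sum.cartesian_product by (intro sum.cong) auto
    also have "\<dots> = (\<Sum>i\<in>K. 2 * int k - 1)"
      using K by (intro sum.cong) (simp_all add: sum_subtractf)
    also have "\<dots> = 2 * int k ^ 2 - int k"
      using K by (simp add: algebra_simps power2_eq_square)
    finally show ?thesis .
  qed
  have "(\<Sum>t\<in>R. \<Sum>w\<in>{2..2 * int k}. (corr k t w)\<^sup>2) = (\<Sum>q\<in>?Q. \<Sum>q'\<in>?Q. T q q')"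
    unfolding sq T_def
    by (subst sum.swap, rule sum.cong[OF refl], rule sum.swap)
  then have "N * (\<Sum>t\<in>R. \<Sum>w\<in>{2..2 * int k}. (corr k t w)\<^sup>2) = (\<Sum>q\<in>?Q. \<Sum>q'\<in>?Q. N * T q q')"
    by (simp add: sum_distrib_left)
  also have "\<dots> \<le> (\<Sum>q\<in>?Q. \<Sum>q'\<in>?Q. (if q' \<in> {q, prod.swap q} then N * int p else 0) + int p)"
    by (intro sum_mono bound)
  also have "\<dots> = (\<Sum>q\<in>?Q. N * int p * (if fst q = snd q then 1 else 2) + int (card ?Q) * int p)"
    by (rule sum.cong[OF refl]) (simp only: sum.distrib card_diag sum_constant)
  also have "\<dots> = N * int p * (2 * int k ^ 2 - int k) + int (card ?Q) * (int (card ?Q) * int p)"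
    by (simp only: sum.distrib sum_distrib_left[symmetric] diag sum_constant)
  also have "int (card ?Q) * (int (card ?Q) * int p) = int k ^ 4 * int p"
    using K by (simp add: card_cartesian_product eval_nat_numeral)
  finally show ?thesis .
qed

text \<open>Otherwise every t outside a set of at most 3 k bad residues violates the last bound. By
  Cauchy-Schwarz over the 2 k - 1 values of w, its sum of squares is then at least 4 k^3 / (2 k -
  1), and summing over these t contradicts the second moment. Bad t are those for which some
  parabola parameter t + i or some sum 2 t + w vanishes mod p.\<close>

lemma exists_good_shift:
  assumes k: "k > 0" and p: "p \<ge> 384 * k ^ 12"
  shows "\<exists>t. (\<forall>i\<in>{1..int k}. \<not> int p dvd t + i) \<and> (\<forall>w\<in>{2..2 * int k}. \<not> int p dvd 2 * t + w)
    \<and> (\<Sum>w\<in>{2..2 * int k}. \<bar>corr k t w\<bar>)\<^sup>2 \<le> 4 * int k ^ 3"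
proof (rule ccontr)
  assume none: "\<not> ?thesis"
  let ?W = "{2..2 * int k}"
  define bad where "bad = (\<Union>i\<in>{1..int k}. {t\<in>R. int p dvd t + i}) \<union> (\<Union>w\<in>?W. {t\<in>R. int p dvd 2 * t + w})"
  have one: "card {t\<in>R. int p dvd m * t + d} \<le> 1" if "\<not> int p dvd m" for m d
  proof -
    have "t = t'" if "t \<in> R" "t' \<in> R" "int p dvd m * t + d" "int p dvd m * t' + d" for t t'
    proof -
      have "int p dvd (m * t + d) - (m * t' + d)" using that dvd_diff by blast
      then have "[m * t = m * t'] (mod int p)" by (simp add: cong_iff_dvd_diff)
      then show ?thesis using \<open>\<not> int p dvd m\<close> that cong_mult_left_iff R_cong_iff by blast
    qed
    then show ?thesis by (auto simp: card_le_Suc0_iff_eq)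
  qed
  have "card bad \<le> card (\<Union>i\<in>{1..int k}. {t\<in>R. int p dvd t + i}) + card (\<Union>w\<in>?W. {t\<in>R. int p dvd 2 * t + w})"
    unfolding bad_def by (rule card_Un_le)
  also have "\<dots> \<le> (\<Sum>i\<in>{1..int k}. 1) + (\<Sum>w\<in>?W. 1)"
    using one[of 1] one[of 2] not_dvd_1 not_dvd_small[of 2] p_gt_3
    by (intro add_mono order_trans[OF card_UN_le] sum_mono) auto
  also have "\<dots> \<le> 3 * k" using k by simp
  finally have card_bad: "card bad \<le> 3 * k" .
  have badR: "bad \<subseteq> R" by (auto simp: bad_def)
  have large: "4 * int k ^ 3 \<le> (2 * int k - 1) * (\<Sum>w\<in>?W. (corr k t w)\<^sup>2)" if t: "t \<in> R - bad" for t
  proof -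
    have "(\<forall>i\<in>{1..int k}. \<not> int p dvd t + i) \<and> (\<forall>w\<in>?W. \<not> int p dvd 2 * t + w)"
      using t by (auto simp: bad_def)
    then have "4 * int k ^ 3 \<le> (\<Sum>w\<in>?W. \<bar>corr k t w\<bar>)\<^sup>2"
      using none by force
    also have "\<dots> \<le> int (card ?W) * (\<Sum>w\<in>?W. \<bar>corr k t w\<bar>\<^sup>2)"
      by (rule sum_power2_le_card_mult)
    also have "\<dots> = (2 * int k - 1) * (\<Sum>w\<in>?W. (corr k t w)\<^sup>2)"
      using k by simp
    finally show ?thesis .
  qed
  \<comment> \<open>The trivial terms give (2 k - 1)(2 k^2 - k) = 4 k^3 - 4 k^2 + k, about 4 k^2
    below the target 4 k^3. With this N the error adds (2 k - 1) k^4 / N < k^2, which fits into the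
    gap. Moreover 24 N^4 = 384 k^12, the assumed lower bound for p.\<close>
  define N where "N = 2 * int k ^ 3"
  define M where "M = (\<Sum>t\<in>R. \<Sum>w\<in>?W. (corr k t w)\<^sup>2)"
  have k1: "1 \<le> int k" using k by simp
  have p': "384 * int k ^ 12 \<le> int p"
    using p by (metis of_nat_le_iff of_nat_mult of_nat_numeral of_nat_power)
  have "int k ^ 4 \<le> int k ^ 12" "1 \<le> int k ^ 12" "int k ^ 3 \<le> int k ^ 12" "int k ^ 2 \<le> int k ^ 12"
    using k1 by (auto intro!: power_increasing)
  note kp = this
  have "N * M \<le> N * int p * (2 * int k ^ 2 - int k) + int k ^ 4 * int p"
    unfolding M_def
  proof (rule corr_second_moment[OF k])
    show "N > 0" using k by (simp add: N_def)
    show "24 * N ^ 4 \<le> int p" using p' by (simp add: N_def power_mult_distrib)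
    show "2 * int k ^ 4 < int p" using kp p' by linarith
  qed
  then have up: "(2 * int k - 1) * (N * M) \<le> (2 * int k - 1) * (N * int p * (2 * int k ^ 2 - int k) + int k ^ 4 * int p)"
    using k1 by (intro mult_left_mono) auto
  have "(int p - 3 * int k) * (4 * int k ^ 3) \<le> int (card (R - bad)) * (4 * int k ^ 3)"
  proof (intro mult_right_mono)
    have "card (R - bad) = p - card bad"
      using card_Diff_subset[OF finite_subset[OF badR finite_R] badR] by simp
    then show "int p - 3 * int k \<le> int (card (R - bad))" using card_bad by linarith
  qed simp
  also have "\<dots> = (\<Sum>t\<in>R - bad. 4 * int k ^ 3)" by simp
  also have "\<dots> \<le> (\<Sum>t\<in>R - bad. (2 * int k - 1) * (\<Sum>w\<in>?W. (corr k t w)\<^sup>2))"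
    by (intro sum_mono large)
  also have "\<dots> \<le> (\<Sum>t\<in>R. (2 * int k - 1) * (\<Sum>w\<in>?W. (corr k t w)\<^sup>2))"
    using k1 by (intro sum_mono2) (auto intro!: mult_nonneg_nonneg sum_nonneg)
  also have "\<dots> = (2 * int k - 1) * M" by (simp add: M_def sum_distrib_left)
  finally have lo: "(int p - 3 * int k) * (4 * int k ^ 3) \<le> (2 * int k - 1) * M" .
  have "N * ((int p - 3 * int k) * (4 * int k ^ 3)) \<le> (2 * int k - 1) * (N * M)"
    using mult_left_mono[OF lo, of N] by (simp add: N_def mult.left_commute)
  with up have "N * ((int p - 3 * int k) * (4 * int k ^ 3))
      \<le> (2 * int k - 1) * (N * int p * (2 * int k ^ 2 - int k) + int k ^ 4 * int p)"
    by linarith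
  moreover have "N * ((int p - 3 * int k) * (4 * int k ^ 3)) = int k ^ 4 * (8 * int k ^ 2 * int p - 24 * int k ^ 3)"
    unfolding N_def by (simp add: algebra_simps eval_nat_numeral)
  moreover have "(2 * int k - 1) * (N * int p * (2 * int k ^ 2 - int k) + int k ^ 4 * int p)
      = int k ^ 4 * (8 * int k ^ 2 * int p - 6 * (int k * int p) + int p)"
    unfolding N_def by (simp add: algebra_simps eval_nat_numeral)
  ultimately have "8 * int k ^ 2 * int p - 24 * int k ^ 3 \<le> 8 * int k ^ 2 * int p - 6 * (int k * int p) + int p"
    using k1 by (simp add: mult_le_cancel_left)
  moreover have "int p * 1 \<le> int p * int k"
    using k1 by (intro mult_left_mono) auto
  \<comment> \<open>After cancelling 8 k^2 p, the main term 6 k p has to be absorbed by p + 24 k^3,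
    which is impossible for p this large.\<close>
  ultimately have "5 * int p \<le> 24 * int k ^ 3"
    by (simp add: mult.commute)
  then show False using kp p' by linarith
qed

end

subsection \<open>Lifting from the plane to a cyclic group\<close>

text \<open>The target (a, b) is taken up to congruence, so that a borrow such as
  \<open>q - 1\<close> below needs no reduction.\<close>

definition plane_reps :: "int \<Rightarrow> (int \<times> int) set \<Rightarrow> int \<Rightarrow> int \<Rightarrow> ((int \<times> int) \<times> int \<times> int) set" where
  "plane_reps P A a b = {(z, z'). z \<in> A \<and> z' \<in> A \<and> [fst z + fst z' = a] (mod P)
     \<and> [snd z + snd z' = b] (mod P)}"

text \<open>In mixed radix, \<alpha> has a lowest digit in base P, a middle digit in base S and a
  top digit. Membership is read off from the outer two and leaves the middle one free.\<close>

definition lift_set :: "int \<Rightarrow> int \<Rightarrow> (int \<times> int) set \<Rightarrow> int set" where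
  "lift_set P S A = {\<alpha> \<in> {0..<P\<^sup>2 * S}. (\<alpha> mod P, \<alpha> div P div S) \<in> A}"

lemma digits_eq: "\<alpha> mod P + P * (\<alpha> div P mod S + S * (\<alpha> div P div S)) = (\<alpha>::int)"
  by (simp only: mod_mult_div_eq)

lemma div_eq_0_or_1:
  fixes x P :: int
  assumes "0 \<le> x" "x < 2 * P"
  shows "x div P = 0 \<or> x div P = 1"
proof (cases "x < P")
  case False
  then have "x div P = (x - P) div P + 1"
    using assms by (simp add: div_pos_geq)
  then show ?thesis using False assms by simp
qed (use assms in simp)

lemma card_lift_set:
  fixes P S :: int
  assumes "P > 0" "S > 0" and A: "A \<subseteq> {0..<P} \<times> {0..<P}"
  shows "card (lift_set P S A) = card A * nat S"
proof -
  define f where "f = (\<lambda>((a, b), c). a + P * (c + S * b))"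
  define g where "g \<alpha> = ((\<alpha> mod P, \<alpha> div P div S), \<alpha> div P mod S)" for \<alpha>
  have dig: "f ((a, b), c) mod P = a" "f ((a, b), c) div P div S = b" "f ((a, b), c) div P mod S = c"
    if "a \<in> {0..<P}" "c \<in> {0..<S}" for a b c
    using that assms by (simp_all add: f_def)
  have rng: "f ((a, b), c) \<in> {0..<P\<^sup>2 * S}"
    if "a \<in> {0..<P}" "b \<in> {0..<P}" "c \<in> {0..<S}" for a b c
  proof -
    have "S * b \<le> S * (P - 1)" using that assms by (intro mult_left_mono) auto
    then have "c + S * b \<le> S * P - 1" using that by (simp add: algebra_simps)
    then have "P * (c + S * b) \<le> P * (S * P - 1)" using assms by (intro mult_left_mono) auto
    then have "f ((a, b), c) < P\<^sup>2 * S"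
      using that by (simp add: f_def algebra_simps power2_eq_square)
    moreover have "0 \<le> f ((a, b), c)"
      using that assms by (simp add: f_def)
    ultimately show ?thesis by simp
  qed
  have "bij_betw f (A \<times> {0..<S}) (lift_set P S A)"
  proof (rule bij_betw_byWitness[where f' = g])
    show "\<forall>x\<in>A \<times> {0..<S}. g (f x) = x"
      using A by (auto simp: g_def dig)
    show "\<forall>\<alpha>\<in>lift_set P S A. f (g \<alpha>) = \<alpha>"
      by (simp add: f_def g_def)
    show "f ` (A \<times> {0..<S}) \<subseteq> lift_set P S A"
    proof (rule image_subsetI)
      fix x assume "x \<in> A \<times> {0..<S}"
      then obtain a b c where x: "x = ((a, b), c)" "(a, b) \<in> A" "c \<in> {0..<S}" by auto
      then have "a \<in> {0..<P}" "b \<in> {0..<P}" using A by auto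
      then show "f x \<in> lift_set P S A"
        using x rng dig unfolding lift_set_def by auto
    qed
    show "g ` lift_set P S A \<subseteq> A \<times> {0..<S}"
      using assms by (auto simp: g_def lift_set_def)
  qed
  then show ?thesis
    by (simp add: bij_betw_same_card[symmetric] card_cartesian_product)
qed

text \<open>Carries: the base-P digit may carry into the middle digit, and the middle digit may carry
  into the top one. In the first case of the union below the middle digits sum to m0 or
  m0 - 1, in the second to m0 + S or m0 + S - 1.\<close>

lemma rep_count_lift_set:
  fixes p s :: nat and g :: int
  assumes "p > 0" "s > 0" and A: "finite A"
    and g: "\<And>a b. int (card (plane_reps (int p) A a b)) \<le> g"
  shows "int (rep_count (p\<^sup>2 * s) (lift_set (int p) (int s) A) n) \<le> g * int (s + 1)"
proof -
  define P S where "P = int p" and "S = int s"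
  have PS: "P > 0" "S > 0" using assms by (simp_all add: P_def S_def)
  define M where "M = P * P * S"
  have M: "int (p\<^sup>2 * s) = M" by (simp add: M_def P_def S_def power2_eq_square)
  define L where "L = lift_set P S A"
  define X where "X = {(a1, a2). a1 \<in> L \<and> a2 \<in> L \<and> (a1 + a2) mod M = n}"
  have rep: "rep_count (p\<^sup>2 * s) (lift_set (int p) (int s) A) n = card X"
    unfolding rep_count_def X_def M by (simp add: residue_ring_def L_def P_def S_def)
  define n0 m0 q where "n0 = n mod P" and "m0 = n div P mod S" and "q = n div P div S"
  define h where "h \<alpha> = (\<alpha> mod P, \<alpha> div P div S)" for \<alpha>
  \<comment> \<open>Of the middle digits only that of \<alpha> is kept: together with the outer
    digits it determines \<alpha>, and \<beta> is then determined modulo M by the sum n.\<close>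
  define \<phi> where "\<phi> = (\<lambda>(\<alpha>, \<beta>). ((h \<alpha>, h \<beta>), \<alpha> div P mod S))"
  \<comment> \<open>The two intervals for the middle digit of \<alpha> share the point
    \<open>m0\<close>, owing to the possible carry from the lowest digit. Their lengths m0 + 1 and S
    - m0 add up to S + 1, the source of the factor s + 1.\<close>
  let ?Y = "plane_reps P A n0 q \<times> {0..m0} \<union> plane_reps P A n0 (q - 1) \<times> {m0..S - 1}"
  have m0: "0 \<le> m0" "m0 < S" using PS by (simp_all add: m0_def)
  have inj: "inj_on \<phi> X"
  proof (rule inj_onI)
    fix x y assume xy: "x \<in> X" "y \<in> X" "\<phi> x = \<phi> y"
    obtain \<alpha> \<beta> \<alpha>' \<beta>' where ab: "x = (\<alpha>, \<beta>)" "y = (\<alpha>', \<beta>')" by (cases x, cases y)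
    have "\<alpha> = \<alpha>'"
    proof -
      have e: "\<alpha> mod P = \<alpha>' mod P" "\<alpha> div P mod S = \<alpha>' div P mod S"
        "\<alpha> div P div S = \<alpha>' div P div S"
        using xy(3) unfolding ab \<phi>_def h_def by simp_all
      have "\<alpha> = \<alpha> mod P + P * (\<alpha> div P mod S + S * (\<alpha> div P div S))"
        by (rule digits_eq[symmetric])
      also have "\<dots> = \<alpha>'" unfolding e by (rule digits_eq)
      finally show ?thesis .
    qed
    moreover have "\<beta> mod M = \<beta>' mod M"
    proof -
      have "[\<alpha> + \<beta> = \<alpha> + \<beta>'] (mod M)"
        using xy(1,2) \<open>\<alpha> = \<alpha>'\<close> by (simp add: X_def ab cong_def)
      then show ?thesis by (simp add: cong_add_lcancel cong_def[symmetric])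
    qed
    moreover have "0 \<le> \<beta>" "\<beta> < M" "0 \<le> \<beta>'" "\<beta>' < M"
      using xy by (auto simp: X_def ab L_def lift_set_def M_def power2_eq_square)
    ultimately show "x = y" by (simp add: ab)
  qed
  have "\<phi> ` X \<subseteq> ?Y"
  proof (rule image_subsetI)
    fix x assume x: "x \<in> X"
    obtain \<alpha> \<beta> where ab: "x = (\<alpha>, \<beta>)" by (cases x)
    have L: "\<alpha> \<in> L" "\<beta> \<in> L" and sum: "(\<alpha> + \<beta>) mod M = n" using x by (auto simp: X_def ab)
    have hA: "h \<alpha> \<in> A" "h \<beta> \<in> A" using L by (auto simp: L_def lift_set_def h_def)
    define a1 a2 c1 c2 b1 b2 where "a1 = \<alpha> mod P" and "a2 = \<beta> mod P"
      and "c1 = \<alpha> div P mod S" and "c2 = \<beta> div P mod S"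
      and "b1 = \<alpha> div P div S" and "b2 = \<beta> div P div S"
    note defs = a1_def a2_def c1_def c2_def b1_def b2_def
    have rng: "0 \<le> a1" "a1 < P" "0 \<le> a2" "a2 < P" "0 \<le> c1" "c1 < S" "0 \<le> c2" "c2 < S"
      using PS by (simp_all add: defs)
    define e where "e = (\<alpha> + \<beta>) div M"
    have s1: "\<alpha> + \<beta> = n + P * (P * S * e)"
    proof -
      have "\<alpha> + \<beta> = (\<alpha> + \<beta>) mod M + M * ((\<alpha> + \<beta>) div M)"
        by (rule mod_mult_div_eq[symmetric])
      also have "\<dots> = n + M * e" by (simp only: sum e_def)
      finally show ?thesis by (simp only: M_def mult.assoc)
    qed
    have s2: "\<alpha> + \<beta> = a1 + a2 + P * (c1 + c2 + S * (b1 + b2))"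
    proof -
      have "\<alpha> = a1 + P * (c1 + S * b1)"
        unfolding a1_def c1_def b1_def by (rule digits_eq[symmetric])
      moreover have "\<beta> = a2 + P * (c2 + S * b2)"
        unfolding a2_def c2_def b2_def by (rule digits_eq[symmetric])
      ultimately have "\<alpha> + \<beta> = a1 + P * (c1 + S * b1) + (a2 + P * (c2 + S * b2))"
        by (rule arg_cong2)
      also have "\<dots> = a1 + a2 + P * (c1 + c2 + S * (b1 + b2))"
        by (simp add: algebra_simps)
      finally show ?thesis .
    qed
    \<comment> \<open>The carry out of the lowest digit; \<open>c\<close> below is the sum of the
      middle digits including this carry.\<close>
    define \<epsilon> where "\<epsilon> = (a1 + a2) div P"
    have n0: "(a1 + a2) mod P = n0"
    proof -
      have "(\<alpha> + \<beta>) mod P = n0" unfolding s1 n0_def by simp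
      then show ?thesis unfolding s2 by simp
    qed
    have \<epsilon>: "0 \<le> \<epsilon>" "\<epsilon> \<le> 1"
      using div_eq_0_or_1[of "a1 + a2" P] rng unfolding \<epsilon>_def by auto
    have a12: "a1 + a2 = n0 + P * \<epsilon>" unfolding \<epsilon>_def n0[symmetric] by simp
    define c where "c = \<epsilon> + c1 + c2"
    have m: "c + S * (b1 + b2) = n div P + S * (P * e)"
    proof -
      have "n0 + P * (\<epsilon> + c1 + c2 + S * (b1 + b2)) = n0 + P * (n div P + P * S * e)"
      proof -
        have "n = n0 + P * (n div P)" unfolding n0_def by simp
        then have "n0 + P * \<epsilon> + P * (c1 + c2 + S * (b1 + b2)) = n0 + P * (n div P) + P * (P * S * e)"
          using s1 s2 unfolding a12 by linarith
        then show ?thesis by (simp only: distrib_left add.assoc)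
      qed
      then have "P * (\<epsilon> + c1 + c2 + S * (b1 + b2)) = P * (n div P + P * S * e)"
        by (simp only: add_left_cancel)
      then have "\<epsilon> + c1 + c2 + S * (b1 + b2) = n div P + P * S * e"
        using PS by simp
      then show ?thesis by (simp only: c_def mult.assoc mult.left_commute)
    qed
    have cm: "c mod S = m0"
    proof -
      have "(c + S * (b1 + b2)) mod S = m0" unfolding m m0_def by simp
      then show ?thesis by simp
    qed
    \<comment> \<open>Wrapping around modulo M changes the sum of the top digits by a multiple of P
      only, which the congruences in \<open>plane_reps\<close> do not see.\<close>
    have cd: "c div S + (b1 + b2) = q + P * e"
    proof -
      have "(c + S * (b1 + b2)) div S = q + P * e"
        unfolding m q_def using PS by simp
      then show ?thesis using PS by simp
    qed
    have "c div S = 0 \<or> c div S = 1"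
      using rng \<epsilon> by (intro div_eq_0_or_1) (auto simp: c_def)
    then consider "c div S = 0" | "c div S = 1" by blast
    moreover have cS: "c = m0 + S * (c div S)" using cm mult_div_mod_eq[of S c] by linarith
    have fst: "[a1 + a2 = n0] (mod P)" using n0 by (simp add: cong_def n0_def)
    have \<phi>: "\<phi> x = (((a1, b1), (a2, b2)), c1)" by (simp add: ab \<phi>_def h_def defs)
    have hA': "(a1, b1) \<in> A" "(a2, b2) \<in> A" using hA by (simp_all add: h_def defs)
    ultimately show "\<phi> x \<in> ?Y"
    proof cases
      case 1
      then have "b1 + b2 = q + P * e" using cd by simp
      then have "[b1 + b2 = q] (mod P)" by (simp add: cong_def)
      moreover have "c = m0" using cS unfolding 1 by linarith
      then have "c1 \<in> {0..m0}" using rng \<epsilon> unfolding c_def by simp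
      ultimately show ?thesis unfolding \<phi> using fst hA' by (simp add: plane_reps_def)
    next
      case 2
      then have "b1 + b2 = (q - 1) + P * e" using cd by simp
      then have "[b1 + b2 = q - 1] (mod P)" by (simp add: cong_def)
      \<comment> \<open>Here c1 = m0 + S - \<epsilon> - c2, and \<epsilon> <= 1, c2 <= S - 1 give c1
        >= m0.\<close>
      moreover have "c = m0 + S" using cS unfolding 2 by linarith
      then have "c1 \<in> {m0..S - 1}" using rng \<epsilon> unfolding c_def by simp
      ultimately show ?thesis unfolding \<phi> using fst hA' by (simp add: plane_reps_def)
    qed
  qed
  moreover have fin: "finite (plane_reps P A a b)" for a b
    by (rule finite_subset[of _ "A \<times> A"]) (auto simp: plane_reps_def A)
  ultimately have "card X \<le> card ?Y"
    using inj by (intro card_inj_on_le[of \<phi>]) auto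
  also have "\<dots> \<le> card (plane_reps P A n0 q \<times> {0..m0}) + card (plane_reps P A n0 (q - 1) \<times> {m0..S - 1})"
    by (rule card_Un_le)
  also have "\<dots> = card (plane_reps P A n0 q) * nat (m0 + 1) + card (plane_reps P A n0 (q - 1)) * nat (S - m0)"
    by (simp add: card_cartesian_product)
  finally have "int (card X) \<le> int (card (plane_reps P A n0 q) * nat (m0 + 1)
      + card (plane_reps P A n0 (q - 1)) * nat (S - m0))"
    by (simp only: of_nat_le_iff)
  also have "\<dots> = int (card (plane_reps P A n0 q)) * (m0 + 1)
      + int (card (plane_reps P A n0 (q - 1))) * (S - m0)"
    using m0 by simp
  also have "\<dots> \<le> g * (m0 + 1) + g * (S - m0)"
    using m0 g by (intro add_mono mult_right_mono) (auto simp: P_def)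
  also have "\<dots> = g * int (s + 1)" by (simp add: S_def algebra_simps)
  finally show ?thesis unfolding rep .
qed

section \<open>Unions of parabolas and their representation counts\<close>

context odd_prime_residues
begin

text \<open>The graph y = x^2/u, with the denominator cleared.\<close>

definition parabola :: "int \<Rightarrow> (int \<times> int) set" where
  "parabola u = {(x, y). x \<in> R \<and> y \<in> R \<and> [u * y = x\<^sup>2] (mod int p)}"

lemma parabola_subset: "parabola u \<subseteq> R \<times> R"
  by (auto simp: parabola_def)

lemma finite_parabola [simp]: "finite (parabola u)"
  by (rule finite_subset[OF parabola_subset]) simp

lemma parabola_snd_unique:
  assumes "\<not> int p dvd u" "(x, y) \<in> parabola u" "(x, y') \<in> parabola u"
  shows "y = y'"
proof -
  have "[u * y = u * y'] (mod int p)"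
    using assms unfolding parabola_def by (auto intro: cong_trans cong_sym)
  then show ?thesis
    using assms cong_mult_left_iff R_cong_iff unfolding parabola_def by blast
qed

lemma card_parabola:
  assumes "\<not> int p dvd u"
  shows "card (parabola u) = p"
proof -
  have "inj_on fst (parabola u)"
    using parabola_snd_unique[OF assms] by (auto simp: inj_on_def)
  moreover have "fst ` parabola u = R"
  proof (intro equalityI subsetI)
    fix x assume x: "x \<in> R"
    have "x\<^sup>2 mod int p \<in> (\<lambda>y. (u * y + 0) mod int p) ` R"
      using bij_betw_affine_mod[OF assms, of 0] by (simp add: bij_betw_def)
    then obtain y where "y \<in> R" "[u * y = x\<^sup>2] (mod int p)" by (auto simp: cong_def)
    then show "x \<in> fst ` parabola u" using x by (force simp: parabola_def)
  qed (auto simp: parabola_def)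
  ultimately show ?thesis by (metis card_R card_image)
qed

lemma zero_in_parabola: "(0, 0) \<in> parabola u"
  using p_gt_3 by (simp add: parabola_def R_def)

text \<open>Subtracting the equations gives (u - u') y = 0 mod p, hence y = 0 and x = 0. The single
  common point accounts for the -k + 1 in the size of the union.\<close>

lemma parabola_Int:
  assumes "\<not> int p dvd u - u'"
  shows "parabola u \<inter> parabola u' = {(0, 0)}"
proof -
  have z: "x = 0" if "x \<in> R" "int p dvd x" for x
    using that zdvd_not_zless[of x "int p"] by (force simp: R_def)
  have "x = 0 \<and> y = 0" if "(x, y) \<in> parabola u" "(x, y) \<in> parabola u'" for x y
  proof -
    have xy: "x \<in> R" "y \<in> R" "[u * y = x\<^sup>2] (mod int p)" "[u' * y = x\<^sup>2] (mod int p)"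
      using that by (auto simp: parabola_def)
    then have "[u * y = u' * y] (mod int p)" by (meson cong_sym cong_trans)
    then have "int p dvd (u - u') * y" by (simp add: cong_iff_dvd_diff left_diff_distrib)
    then have y: "int p dvd y" using assms prime_int_p by (simp add: prime_dvd_mult_iff)
    then have "int p dvd x\<^sup>2" using xy(3) cong_dvd_iff dvd_mult by blast
    then show ?thesis using z xy y dvd_power2_iff by blast
  qed
  then show ?thesis using zero_in_parabola by auto
qed

text \<open>Eliminating x2, y1 and y2 leaves the quadratic u v b = v x1^2 + u (a - x1)^2 in x1.
  Multiplying by u + v completes the square: (u + v) x1 - u a is a square root of \<open>D\<close>.
  As u, v and u + v are units, this root determines the whole pair of points, and
  \<open>card_sqrt\<close> bounds the number of roots.\<close>

lemma card_parabola_pairs: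
  assumes nz: "\<not> int p dvd u" "\<not> int p dvd v" "\<not> int p dvd u + v"
  shows "int (card {(z, z'). z \<in> parabola u \<and> z' \<in> parabola v \<and> [fst z + fst z' = a] (mod int p)
      \<and> [snd z + snd z' = b] (mod int p)}) \<le> 1 + chi u * chi v * chi ((u + v) * b - a\<^sup>2)"
    (is "int (card ?X) \<le> _")
proof -
  define D where "D = u * v * ((u + v) * b - a\<^sup>2)"
  define \<phi> where "\<phi> = (\<lambda>(z::int \<times> int, z'::int \<times> int). ((u + v) * fst z + - (u * a)) mod int p)"
  have "inj_on \<phi> ?X"
  proof (rule inj_onI)
    fix X X' assume X: "X \<in> ?X" "X' \<in> ?X" and eq: "\<phi> X = \<phi> X'"
    obtain x1 y1 x2 y2 where e: "X = ((x1, y1), (x2, y2))" by (metis surj_pair)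
    obtain x1' y1' x2' y2' where e': "X' = ((x1', y1'), (x2', y2'))" by (metis surj_pair)
    have R: "x1 \<in> R" "x2 \<in> R" "x1' \<in> R" "x2' \<in> R" using X by (auto simp: e e' parabola_def)
    have "x1 = x1'"
    proof (rule inj_onD)
      show "inj_on (\<lambda>x. ((u + v) * x + - (u * a)) mod int p) R"
        using bij_betw_affine_mod[OF nz(3)] by (rule bij_betw_imp_inj_on)
      show "((u + v) * x1 + - (u * a)) mod int p = ((u + v) * x1' + - (u * a)) mod int p"
        using eq by (simp only: e e' \<phi>_def prod.case fst_conv)
    qed (fact R)+
    have "[x1 + x2 = x1 + x2'] (mod int p)"
      using X \<open>x1 = x1'\<close> by (auto simp: e e' intro: cong_trans cong_sym)
    then have "x2 = x2'" using R R_cong_iff by (simp add: cong_add_lcancel)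
    then show "X = X'"
      using X \<open>x1 = x1'\<close> parabola_snd_unique[OF nz(1)] parabola_snd_unique[OF nz(2)]
      unfolding e e' by auto
  qed
  moreover have "\<phi> ` ?X \<subseteq> {z \<in> R. [z\<^sup>2 = D] (mod int p)}"
  proof (rule image_subsetI)
    fix X assume X: "X \<in> ?X"
    obtain x1 y1 x2 y2 where e: "X = ((x1, y1), (x2, y2))" by (metis surj_pair)
    have h: "[u * y1 = x1\<^sup>2] (mod int p)" "[v * y2 = x2\<^sup>2] (mod int p)"
      "[x1 + x2 = a] (mod int p)" "[y1 + y2 = b] (mod int p)"
      using X by (auto simp: e parabola_def)
    have x2: "[x2 = a - x1] (mod int p)"
      using cong_diff[OF h(3) cong_refl[of x1]] by simp
    have "[u * v * b = u * v * (y1 + y2)] (mod int p)"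
      using h(4) by (intro cong_mult cong_refl) (rule cong_sym)
    also have "u * v * (y1 + y2) = v * (u * y1) + u * (v * y2)"
      by (simp add: algebra_simps)
    also have "[\<dots> = v * x1\<^sup>2 + u * (a - x1)\<^sup>2] (mod int p)"
      using cong_trans[OF h(2) cong_pow[OF x2, of 2]]
      by (intro cong_add cong_mult cong_refl h(1))
    finally have uvb: "[u * v * b = v * x1\<^sup>2 + u * (a - x1)\<^sup>2] (mod int p)" .
    have "((u + v) * x1 + - (u * a))\<^sup>2
        = (u + v) * (v * x1\<^sup>2 + u * (a - x1)\<^sup>2) - u * v * a\<^sup>2"
      by (simp add: algebra_simps power2_eq_square)
    moreover have "[\<dots> = (u + v) * (u * v * b) - u * v * a\<^sup>2] (mod int p)"
      by (intro cong_diff cong_mult cong_refl cong_sym[OF uvb])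
    moreover have "(u + v) * (u * v * b) - u * v * a\<^sup>2 = D"
      by (simp add: D_def algebra_simps)
    ultimately have "[((u + v) * x1 + - (u * a))\<^sup>2 = D] (mod int p)" by simp
    then show "\<phi> X \<in> {z \<in> R. [z\<^sup>2 = D] (mod int p)}"
      by (simp add: \<phi>_def e cong_def power_mod)
  qed
  ultimately have "card ?X \<le> card {z \<in> R. [z\<^sup>2 = D] (mod int p)}"
    by (rule card_inj_on_le) simp
  then show ?thesis using card_sqrt[of D] by (simp add: D_def chi_mult)
qed

definition parabolas :: "nat \<Rightarrow> int \<Rightarrow> (int \<times> int) set" where
  "parabolas k t = (\<Union>i\<in>{1..int k}. parabola (t + i))"

lemma finite_parabolas: "finite (parabolas k t)"
  by (simp add: parabolas_def)

text \<open>Without the origin the k parabolas are disjoint, their parameters being distinct mod p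
  as k < p, and each has p - 1 points.\<close>

lemma card_parabolas:
  assumes k: "k > 0" "k < p" and t: "\<And>i. i \<in> {1..int k} \<Longrightarrow> \<not> int p dvd t + i"
  shows "card (parabolas k t) = k * p - k + 1"
proof -
  define B where "B i = parabola (t + i) - {(0, 0)}" for i
  have "card (\<Union>i\<in>{1..int k}. B i) = (\<Sum>i\<in>{1..int k}. card (B i))"
  proof (rule card_UN_disjoint)
    show "\<forall>i\<in>{1..int k}. \<forall>j\<in>{1..int k}. i \<noteq> j \<longrightarrow> B i \<inter> B j = {}"
    proof (intro ballI impI)
      fix i j assume ij: "i \<in> {1..int k}" "j \<in> {1..int k}" "i \<noteq> j"
      then have "\<not> int p dvd \<bar>i - j\<bar>" using k by (intro not_dvd_small) auto
      then have "\<not> int p dvd (t + i) - (t + j)" by simp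
      from parabola_Int[OF this] show "B i \<inter> B j = {}" unfolding B_def by blast
    qed
  qed (simp_all add: B_def)
  also have "\<dots> = (\<Sum>i\<in>{1..int k}. p - 1)"
    using t zero_in_parabola by (intro sum.cong refl) (simp add: B_def card_parabola)
  also have "\<dots> = k * p - k" by (simp add: diff_mult_distrib2)
  finally have "card (\<Union>i\<in>{1..int k}. B i) = k * p - k" .
  moreover have "parabolas k t = insert (0, 0) (\<Union>i\<in>{1..int k}. B i)"
    unfolding parabolas_def B_def using k zero_in_parabola[of "t + 1"] by (auto intro!: bexI[of _ 1])
  moreover have "(0, 0) \<notin> (\<Union>i\<in>{1..int k}. B i)" "finite (\<Union>i\<in>{1..int k}. B i)"
    by (auto simp: B_def)
  ultimately show ?thesis by simp
qed

text \<open>The second character depends only on w = i + j, so it factors out of each antidiagonal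
  and leaves \<open>corr\<close>. Between different w only its absolute value, at most 1, is
  used.\<close>

lemma card_plane_reps_parabolas:
  assumes t: "\<And>i. i \<in> {1..int k} \<Longrightarrow> \<not> int p dvd t + i"
    and t2: "\<And>w. w \<in> {2..2 * int k} \<Longrightarrow> \<not> int p dvd 2 * t + w"
  shows "int (card (plane_reps (int p) (parabolas k t) a b))
    \<le> int k ^ 2 + (\<Sum>w\<in>{2..2 * int k}. \<bar>corr k t w\<bar>)"
proof -
  let ?K = "{1..int k}"
  define X where "X i j = {(z, z'). z \<in> parabola (t + i) \<and> z' \<in> parabola (t + j)
      \<and> [fst z + fst z' = a] (mod int p) \<and> [snd z + snd z' = b] (mod int p)}" for i j
  define E where "E w = chi ((2 * t + w) * b - a\<^sup>2)" for w
  \<comment> \<open>The origin lies on every parabola, so these sets may overlap; the sum over (i,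
    j) is an upper bound.\<close>
  have "plane_reps (int p) (parabolas k t) a b = (\<Union>q\<in>?K \<times> ?K. X (fst q) (snd q))"
    unfolding plane_reps_def parabolas_def X_def by auto
  then have "card (plane_reps (int p) (parabolas k t) a b) \<le> (\<Sum>q\<in>?K \<times> ?K. card (X (fst q) (snd q)))"
    by (simp add: card_UN_le)
  then have "int (card (plane_reps (int p) (parabolas k t) a b))
      \<le> (\<Sum>q\<in>?K \<times> ?K. int (card (X (fst q) (snd q))))"
    by (simp only: of_nat_sum[symmetric] of_nat_le_iff)
  also have "\<dots> \<le> (\<Sum>q\<in>?K \<times> ?K. 1 + chi (t + fst q) * chi (t + snd q) * E (fst q + snd q))"
  proof (rule sum_mono)
    fix q assume "q \<in> ?K \<times> ?K"
    then have q: "fst q \<in> ?K" "snd q \<in> ?K" by auto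
    then have "fst q + snd q \<in> {2..2 * int k}" by auto
    from t2[OF this] have "\<not> int p dvd (t + fst q) + (t + snd q)" by (simp add: algebra_simps)
    from card_parabola_pairs[OF t[OF q(1)] t[OF q(2)] this]
    show "int (card (X (fst q) (snd q))) \<le> 1 + chi (t + fst q) * chi (t + snd q) * E (fst q + snd q)"
      unfolding X_def E_def by (simp add: algebra_simps)
  qed
  also have "\<dots> = int k ^ 2 + (\<Sum>q\<in>?K \<times> ?K. chi (t + fst q) * chi (t + snd q) * E (fst q + snd q))"
    by (simp add: sum.distrib card_cartesian_product power2_eq_square)
  also have "(\<Sum>q\<in>?K \<times> ?K. chi (t + fst q) * chi (t + snd q) * E (fst q + snd q))
      = (\<Sum>w\<in>{2..2 * int k}. \<Sum>q | q \<in> ?K \<times> ?K \<and> fst q + snd q = w.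
          chi (t + fst q) * chi (t + snd q) * E (fst q + snd q))"
    by (rule sum.group[symmetric]) auto
  also have "\<dots> = (\<Sum>w\<in>{2..2 * int k}. corr k t w * E w)"
    unfolding corr_def sum_distrib_right
    by (intro sum.cong refl) (auto simp: case_prod_unfold)
  also have "\<dots> \<le> (\<Sum>w\<in>{2..2 * int k}. \<bar>corr k t w\<bar>)"
  proof (rule sum_mono)
    fix w
    have "c * chi x \<le> \<bar>c\<bar>" for c x
      using chi_cases[of x] by auto
    then show "corr k t w * E w \<le> \<bar>corr k t w\<bar>" by (simp add: E_def)
  qed
  finally show ?thesis by simp
qed

end

section \<open>Combination of the good shift, the parabolas and the lift\<close>

theorem theorem6:
  fixes k s :: nat
  assumes "k > 0" and "s > 0"
  shows "\<exists>p0::nat. \<forall>p::nat. prime p \<and> p \<ge> p0 \<longrightarrow>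
    (\<exists>A. A \<subseteq> carrier (residue_ring (int (p\<^sup>2 * s))) \<and>
         card A = (k * p - k + 1) * s \<and>
         g_sidon (p\<^sup>2 * s) (\<lfloor>real k ^ 2 + 2 * real k powr (3 / 2)\<rfloor> * int (s + 1)) A)"
\<comment> \<open>The threshold of \<open>exists_good_shift\<close>; it also ensures p > 3 and k <
  p.\<close>
proof (intro exI[of _ "384 * k ^ 12"] allI impI)
  fix p :: nat
  assume p: "prime p \<and> p \<ge> 384 * k ^ 12"
  have k12: "1 \<le> k ^ 12" "k \<le> k ^ 12"
    using \<open>k > 0\<close> by (auto intro: self_le_power)
  interpret odd_prime_residues p
    using p k12 by unfold_locales auto
  obtain t where t: "\<And>i. i \<in> {1..int k} \<Longrightarrow> \<not> int p dvd t + i"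
    "\<And>w. w \<in> {2..2 * int k} \<Longrightarrow> \<not> int p dvd 2 * t + w"
    and corr: "(\<Sum>w\<in>{2..2 * int k}. \<bar>corr k t w\<bar>)\<^sup>2 \<le> 4 * int k ^ 3"
    using exists_good_shift[OF \<open>k > 0\<close>] p by blast
  define C where "C = (\<Sum>w\<in>{2..2 * int k}. \<bar>corr k t w\<bar>)"
  define g where "g = \<lfloor>real k ^ 2 + 2 * real k powr (3 / 2)\<rfloor>"
  \<comment> \<open>4 k^3 is the square of 2 k^(3/2). As \<open>k^2 + C\<close> is an integer, the
    real bound passes to the floor.\<close>
  have "int k ^ 2 + C \<le> g"
  proof -
    have "(real_of_int C)\<^sup>2 \<le> real_of_int (4 * int k ^ 3)"
      using corr unfolding C_def[symmetric] by (metis of_int_le_iff of_int_power)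
    also have "\<dots> = (2 * real k powr (3 / 2))\<^sup>2"
    proof -
      have "(real k powr (3 / 2))\<^sup>2 = real k powr 3"
        by (simp add: power2_eq_square powr_add[symmetric])
      then show ?thesis using \<open>k > 0\<close> by (simp add: power_mult_distrib)
    qed
    finally have "real_of_int C \<le> 2 * real k powr (3 / 2)"
      by (rule power2_le_imp_le) simp
    then have "real_of_int (int k ^ 2 + C) \<le> real k ^ 2 + 2 * real k powr (3 / 2)"
      by simp
    then show ?thesis unfolding g_def by (simp only: le_floor_iff)
  qed
  define A where "A = lift_set (int p) (int s) (parabolas k t)"
  have "parabolas k t \<subseteq> {0..<int p} \<times> {0..<int p}"
    using parabola_subset unfolding parabolas_def R_def by blast
  then have "card A = (k * p - k + 1) * s"
    using card_lift_set[of "int p" "int s" "parabolas k t"] card_parabolas[of k t] t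
      \<open>k > 0\<close> \<open>s > 0\<close> p_gt_3 p k12 by (simp add: A_def)
  moreover have sub: "A \<subseteq> carrier (residue_ring (int (p\<^sup>2 * s)))"
    by (auto simp: A_def lift_set_def residue_ring_def)
  moreover have "int (rep_count (p\<^sup>2 * s) A n) \<le> g * int (s + 1)" for n
    unfolding A_def
  proof (rule rep_count_lift_set)
    show "int (card (plane_reps (int p) (parabolas k t) a b)) \<le> g" for a b
    proof -
      have "int (card (plane_reps (int p) (parabolas k t) a b)) \<le> int k ^ 2 + C"
        unfolding C_def using t by (intro card_plane_reps_parabolas) blast+
      then show ?thesis using \<open>int k ^ 2 + C \<le> g\<close> by linarith
    qed
  qed (use \<open>s > 0\<close> p_gt_3 finite_parabolas in auto)
  ultimately show "\<exists>A. A \<subseteq> carrier (residue_ring (int (p\<^sup>2 * s))) \<and>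
         card A = (k * p - k + 1) * s \<and>
         g_sidon (p\<^sup>2 * s) (\<lfloor>real k ^ 2 + 2 * real k powr (3 / 2)\<rfloor> * int (s + 1)) A"
    unfolding g_sidon_def g_def[symmetric] by blast
qed

end
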